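(* Let $\mathcal{G}=(B\cup I,E)$ be a bipartite graph with a set $B$ of buyers and a set $I$ of items. For each edge $e\in E$ let $D_e$ be a distribution over nonnegative reals, independent across edges; for each edge a reward $r_e\sim D_e$ and a single sample $s_e\sim D_e$ are drawn, all independently. Consider the following online algorithm. Compute the greedy matching $M_S$ with respect to the sample weights (process edges in non-increasing order of $s_e$, ties broken uniformly at random, adding an edge whenever the result is still a matching). For each $e=\{b,i\}\in M_S$ set $p_b=p_i=s_e$; for each vertex $k$ unmatched in $M_S$ set $p_k=0$. Start with $M=\emptyset$. Buyers arrive one at a time in an arbitrary (adversarial) order; when buyer $b$ arrives, the rewards of all edges incident to $b$ are revealed, and, if the set of edges $e=\{b,i\}$ with $r_e\ge\max\{p_b,p_i\}$ is nonempty, let $\hat e=\{b,i^*\}$ be the one of maximum reward among them; if $i^*$ is not yet matched in $M$, add $\hat e$ to $M$ with weight $r_{\hat e}$ (otherwise $b$ stays unmatched). Then, for any arrival order, $8\cdot\mathbb{E}[w(M)]\ge\mathbb{E}[\mathsf{OPT}]$, where $w(M)=\sum_{e\in M}r_e$ and $\mathsf{OPT}$ is the weight of a maximum-weight matching of $\mathcal{G}$ with respect to the rewards.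
   Context: Single-sample prophet inequality setting for bipartite matching with (one-sided) vertex arrivals: items are available offline, buyers arrive online, and on arrival of a buyer all her incident edge rewards are observed; decisions are irrevocable.
   Formalization: Ties are broken by one uniformly random ranking of all rewards and samples, also in the test r_e ≥ max{p_b,p_i} and in the choice of maximum reward; with the plain test the claim fails for distributions with atoms, while for atomless D_e nothing changes. *)

theory Defs
  imports "HOL-Probability.Probability"
begin

definition bipartite_graph :: "'v set \<Rightarrow> 'v set \<Rightarrow> 'v set set \<Rightarrow> bool" where
  "bipartite_graph B I E \<longleftrightarrow>
     finite B \<and> finite I \<and> B \<inter> I = {} \<and> E \<subseteq> {{b, i} |b i. b \<in> B \<and> i \<in> I}"

definition matching :: "'v set set \<Rightarrow> bool" where
  "matching M \<longleftrightarrow> pairwise disjnt M"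

definition weight :: "('v set \<Rightarrow> real) \<Rightarrow> 'v set set \<Rightarrow> real" where
  "weight r M = (\<Sum>e\<in>M. r e)"

definition OPT :: "'v set set \<Rightarrow> ('v set \<Rightarrow> real) \<Rightarrow> real" where
  "OPT E r = Max (weight r ` {M. M \<subseteq> E \<and> matching M})"


text \<open>
  The algorithm is written over an arbitrary linear order of values with a zero. At type \<open>real\<close>
  it is the algorithm without tie-breaking; the choices made by \<open>SOME\<close> and \<open>arg_max_on\<close> are
  unique whenever all values involved are distinct.
\<close>

definition greedy_matching :: "'v set set \<Rightarrow> ('v set \<Rightarrow> 'k::linorder) \<Rightarrow> 'v set set" where
  "greedy_matching E s =
     foldl (\<lambda>M e. if matching (insert e M) then insert e M else M) {}
       (SOME es. distinct es \<and> set es = E \<and> sorted_wrt (\<lambda>e f. s e \<ge> s f) es)"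

definition price :: "'v set set \<Rightarrow> ('v set \<Rightarrow> 'k::{linorder,zero}) \<Rightarrow> 'v \<Rightarrow> 'k" where
  "price E s k =
     (let MS = greedy_matching E s in
      if k \<in> \<Union>MS then s (THE e. e \<in> MS \<and> k \<in> e) else 0)"

definition eligible ::
  "'v set set \<Rightarrow> ('v set \<Rightarrow> 'k::{linorder,zero}) \<Rightarrow> ('v set \<Rightarrow> 'k) \<Rightarrow> 'v \<Rightarrow> 'v set set" where
  "eligible E s r b = {e \<in> E. b \<in> e \<and> r e \<ge> Max (price E s ` e)}"

definition arrival_step ::
  "'v set set \<Rightarrow> ('v set \<Rightarrow> 'k::{linorder,zero}) \<Rightarrow> ('v set \<Rightarrow> 'k) \<Rightarrow>
   'v set set \<Rightarrow> 'v \<Rightarrow> 'v set set" where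
  "arrival_step E s r M b =
     (let C = eligible E s r b; e = arg_max_on r C in
      if C \<noteq> {} \<and> (e - {b}) \<inter> \<Union>M = {} then insert e M else M)"

definition online_matching ::
  "'v set set \<Rightarrow> ('v set \<Rightarrow> 'k::{linorder,zero}) \<Rightarrow> ('v set \<Rightarrow> 'k) \<Rightarrow> 'v list \<Rightarrow> 'v set set" where
  "online_matching E s r bs = foldl (arrival_step E s r) {} bs"


text \<open>
  Uniformly random tie-breaking: every drawn value carries its rank in a uniformly random strict
  ranking of all \<open>2 * card E\<close> draws, and values are compared first by size, then by rank. The same
  ranking resolves all comparisons: sample against sample (greedy), reward against reward (the
  edge of maximum reward) and reward against price. If the real values are pairwise distinct, the
  ranks play no role. Breaking ties also in the price test is essential: with the plain test on
  reals, let all values be deterministic, let \<open>n\<close> buyers share an item of value 2 and let each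
  have a private item of value 1; then every buyer requests the shared item, so the algorithm earns
  2 while the optimum is \<open>n + 1\<close>.
\<close>

datatype key = Key (key_value: real) (key_rank: nat)

instantiation key :: "{linorder, zero}"
begin

definition less_eq_key :: "key \<Rightarrow> key \<Rightarrow> bool" where
  "x \<le> y \<longleftrightarrow> key_value x < key_value y \<or> key_value x = key_value y \<and> key_rank x \<le> key_rank y"

definition less_key :: "key \<Rightarrow> key \<Rightarrow> bool" where
  "x < y \<longleftrightarrow> key_value x < key_value y \<or> key_value x = key_value y \<and> key_rank x < key_rank y"

definition zero_key :: key where
  "0 = Key 0 0"

instance
  by standard (auto simp: less_eq_key_def less_key_def key.expand)

end

datatype 'e draw = Reward (drawn_edge: 'e) | Sample (drawn_edge: 'e)

definition draws :: "'e set \<Rightarrow> 'e draw set" where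
  "draws E = Reward ` E \<union> Sample ` E"

definition rankings :: "'a set \<Rightarrow> ('a \<Rightarrow> nat) set" where
  "rankings A = {\<tau> \<in> A \<rightarrow>\<^sub>E {..<card A}. bij_betw \<tau> A {..<card A}}"

type_synonym 'e outcome = "('e draw \<Rightarrow> real) \<times> ('e draw \<Rightarrow> nat)"

definition outcomes :: "'e set \<Rightarrow> ('e \<Rightarrow> real measure) \<Rightarrow> 'e outcome measure" where
  "outcomes E D =
     (\<Pi>\<^sub>M x\<in>draws E. D (drawn_edge x)) \<Otimes>\<^sub>M uniform_count_measure (rankings (draws E))"

definition reward :: "'e outcome \<Rightarrow> 'e \<Rightarrow> real" where
  "reward \<omega> e = fst \<omega> (Reward e)"

definition reward_key :: "'e outcome \<Rightarrow> 'e \<Rightarrow> key" where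
  "reward_key \<omega> e = Key (fst \<omega> (Reward e)) (snd \<omega> (Reward e))"

definition sample_key :: "'e outcome \<Rightarrow> 'e \<Rightarrow> key" where
  "sample_key \<omega> e = Key (fst \<omega> (Sample e)) (snd \<omega> (Sample e))"

definition alg_matching :: "'v set set \<Rightarrow> 'v set outcome \<Rightarrow> 'v list \<Rightarrow> 'v set set" where
  "alg_matching E \<omega> bs = online_matching E (sample_key \<omega>) (reward_key \<omega>) bs"

end

theory Submission
  imports Defs
begin

text \<open>
  Inspect all draws in decreasing order. Given the pair of values drawn for an edge, it is a fair coin
  whether the larger one is the reward (heads) or the sample (tails). An edge is \<^emph>\<open>open\<close> if the
  sample matching misses both of its ends when its larger draw, the peak, is inspected; tails then
  puts it into the sample matching, and heads makes it eligible. So buyers request exactly their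
  first open edge, the \<^emph>\<open>lead\<close>, and do so iff its coin shows heads. Every sample price at a buyer is at
  most the peak of her lead, so the leads have at least the weight of the sample greedy matching,
  whose expectation is at least half the optimum. A lead is requested with probability one half.
  Whatever the arrival order, an item that is requested earns at least its least request; and a
  request is the least one unless the next lead at the same item shows heads, so with conditional
  probability at least one half. The total loss is a factor 8. Since the coins of later edges do not
  influence what happened before, both probability estimates are obtained by exchanging the two
  draws of a single edge, which preserves the measure.
\<close>

section \<open>Greedy matchings\<close>

text \<open>A fixed-point description of the greedy output that mentions no processing order. It
  allows two weight assignments to be compared and turns membership into a finite Boolean
  combination of comparisons.\<close>

definition is_greedy :: "'v set set \<Rightarrow> ('v set \<Rightarrow> 'k::linorder) \<Rightarrow> 'v set set \<Rightarrow> bool" where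
  "is_greedy E s M \<longleftrightarrow> M \<subseteq> E \<and> (\<forall>e\<in>E. e \<in> M \<longleftrightarrow> (\<forall>f\<in>M. s e < s f \<longrightarrow> disjnt e f))"

text \<open>Locality of greedy: the fate of \<open>e\<close> is decided by edges of value at least
  that of \<open>e\<close>. The induction is on the number of heavier edges. The hypothesis on
  values is a disjunction so that no edge can rise above \<open>e\<close> in only one of the two
  assignments.\<close>

lemma is_greedy_agree:
  assumes "finite E" "is_greedy E s M" "is_greedy E s' M'" "e \<in> E"
    and "\<And>f. f \<in> E \<Longrightarrow> s e \<le> s f \<or> s e \<le> s' f \<Longrightarrow> s f = s' f"
  shows "e \<in> M \<longleftrightarrow> e \<in> M'"
  using assms(4,5)
proof (induction "card {f \<in> E. s e < s f}" arbitrary: e rule: less_induct)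
  case less
  have eq: "s e = s' e"
    using less.prems by simp
  have IH: "f \<in> M \<longleftrightarrow> f \<in> M'" if "f \<in> E" "s e < s f" for f
  proof (rule less.hyps)
    have "{h \<in> E. s f < s h} \<subset> {h \<in> E. s e < s h}"
      using that by auto
    then show "card {h \<in> E. s f < s h} < card {h \<in> E. s e < s h}"
      using \<open>finite E\<close> by (intro psubset_card_mono) auto
    show "s h = s' h" if "h \<in> E" "s f \<le> s h \<or> s f \<le> s' h" for h
      using less.prems(2)[of h] less.prems(2)[of f] that \<open>s e < s f\<close> \<open>f \<in> E\<close> by force
  qed (use that in auto)
  have "s e < s f \<longleftrightarrow> s' e < s' f" if "f \<in> E" for f
    using less.prems(2)[OF that] eq by (metis less_imp_le)
  then have "(\<forall>f\<in>M. s e < s f \<longrightarrow> disjnt e f) \<longleftrightarrow> (\<forall>f\<in>M'. s' e < s' f \<longrightarrow> disjnt e f)"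
    using IH assms(2,3) unfolding is_greedy_def by blast
  then show ?case
    using assms(2,3) less.prems(1) unfolding is_greedy_def by simp
qed

lemma is_greedy_unique:
  assumes "finite E" "is_greedy E s M" "is_greedy E s M'"
  shows "M = M'"
  using is_greedy_agree[OF assms] assms(2,3) unfolding is_greedy_def by blast

text \<open>The last edge of the list is strictly lightest by injectivity. Hence it cannot block any
  earlier edge, and its own criterion reduces to disjointness from everything chosen so far.\<close>

lemma foldl_greedy:
  fixes s :: "'v set \<Rightarrow> 'k::linorder"
  assumes "distinct es" "inj_on s (set es)" "sorted_wrt (\<lambda>e f. s e \<ge> s f) es"
  defines "M \<equiv> foldl (\<lambda>M e. if matching (insert e M) then insert e M else M) {} es"
  shows "matching M \<and> is_greedy (set es) s M"
  using assms(1-3) unfolding M_def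
proof (induction es rule: rev_induct)
  case Nil
  then show ?case
    by (simp add: matching_def is_greedy_def)
next
  case (snoc a es)
  define N where "N = foldl (\<lambda>M e. if matching (insert e M) then insert e M else M) {} es"
  have N: "matching N" "N \<subseteq> set es"
    "\<And>e. e \<in> set es \<Longrightarrow> e \<in> N \<longleftrightarrow> (\<forall>f\<in>N. s e < s f \<longrightarrow> disjnt e f)"
    using snoc unfolding N_def is_greedy_def by (auto simp: sorted_wrt_append)
  have less: "s a < s e" if "e \<in> set es" for e
  proof -
    have "s a \<noteq> s e"
      using snoc.prems(1,2) that by (auto simp: inj_on_def)
    then show ?thesis
      using snoc.prems(3) that by (auto simp: sorted_wrt_append)
  qed
  have ins: "matching (insert a N) \<longleftrightarrow> (\<forall>f\<in>N. disjnt a f)"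
    using N(1,2) snoc.prems(1) unfolding matching_def pairwise_insert
    by (auto simp: disjnt_sym)
  have "a \<notin> N"
    using N(2) less by blast
  have "is_greedy (set (es @ [a])) s (if matching (insert a N) then insert a N else N)"
    unfolding is_greedy_def
  proof (intro conjI ballI)
    show "(if matching (insert a N) then insert a N else N) \<subseteq> set (es @ [a])"
      using N(2) by auto
  next
    fix e
    assume e: "e \<in> set (es @ [a])"
    show "e \<in> (if matching (insert a N) then insert a N else N) \<longleftrightarrow>
       (\<forall>f\<in>if matching (insert a N) then insert a N else N. s e < s f \<longrightarrow> disjnt e f)"
    proof (cases "e = a")
      case True
      then show ?thesis
        using ins N(2) less \<open>a \<notin> N\<close> by auto
    next
      case False
      then have "e \<in> set es"
        using e by simp
      then show ?thesis
        using N(3)[of e] less[of e] False by auto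
    qed
  qed
  then show ?case
    using N(1) by (simp add: N_def[symmetric])
qed

lemma greedy_matching_greedy:
  fixes s :: "'v set \<Rightarrow> 'k::linorder"
  assumes "finite E" "inj_on s E"
  shows "matching (greedy_matching E s)" "is_greedy E s (greedy_matching E s)"
proof -
  obtain xs where xs: "set xs = E" "distinct xs"
    using finite_distinct_list[OF assms(1)] by auto
  let ?P = "\<lambda>es. distinct es \<and> set es = E \<and> sorted_wrt (\<lambda>e f. s e \<ge> s f) es"
  have "sorted_wrt (\<lambda>e f. s e \<le> s f) (sort_key s xs)"
    using sorted_sort_key[of s xs] by (simp add: sorted_wrt_map)
  \<comment> \<open>Some list meets the specification, so the list picked by \<open>SOME\<close>
    meets it as well.\<close>
  then have "?P (rev (sort_key s xs))"
    using xs by (simp add: sorted_wrt_rev)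
  then have "?P (SOME es. ?P es)"
    by (rule someI)
  then show "matching (greedy_matching E s)" "is_greedy E s (greedy_matching E s)"
    using foldl_greedy[of "SOME es. ?P es" s] assms(2) unfolding greedy_matching_def by auto
qed

lemma arg_max_on_finite:
  fixes f :: "'a \<Rightarrow> 'b::linorder"
  assumes "finite S" "S \<noteq> {}"
  shows "arg_max_on f S \<in> S" "\<And>x. x \<in> S \<Longrightarrow> f x \<le> f (arg_max_on f S)"
proof -
  have "Max (f ` S) \<in> f ` S"
    using assms by (intro Max_in) auto
  then obtain x where "x \<in> S" "f x = Max (f ` S)"
    by auto
  then have "is_arg_max f (\<lambda>x. x \<in> S) x"
    using assms(1) by (simp add: is_arg_max_linorder)
  then have "is_arg_max f (\<lambda>x. x \<in> S) (arg_max_on f S)"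
    unfolding arg_max_on_def arg_max_def by (rule someI)
  then show "arg_max_on f S \<in> S" "\<And>x. x \<in> S \<Longrightarrow> f x \<le> f (arg_max_on f S)"
    by (auto simp: is_arg_max_linorder)
qed

lemma bipartite_graph_edge:
  assumes "bipartite_graph B I E" "e \<in> E"
  obtains b i where "b \<in> B" "i \<in> I" "e = {b, i}" "b \<notin> I" "i \<notin> B"
  using assms unfolding bipartite_graph_def by blast

lemma bipartite_graph_finite:
  assumes "bipartite_graph B I E"
  shows "finite E"
proof (rule finite_subset)
  show "E \<subseteq> (\<lambda>(b, i). {b, i}) ` (B \<times> I)"
    using assms unfolding bipartite_graph_def by auto
  show "finite ((\<lambda>(b, i). {b, i}) ` (B \<times> I))"
    using assms unfolding bipartite_graph_def by auto
qed

lemma matching_disjoint: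
  "matching M \<Longrightarrow> e \<in> M \<Longrightarrow> f \<in> M \<Longrightarrow> k \<in> e \<Longrightarrow> k \<in> f \<Longrightarrow> e = f"
  unfolding matching_def pairwise_def disjnt_def by blast

text \<open>Each edge of \<open>N\<close> meets a greedy edge that is at least as heavy (possibly
  itself) and is charged to a common end. Since \<open>N\<close> is a matching, each end of a greedy
  edge is charged at most once, and an edge has two ends. The order \<open>s\<close> may refine
  \<open>w\<close>, which accommodates tie-breaking.\<close>

lemma weight_matching_le_twice_greedy:
  fixes w :: "'v set \<Rightarrow> real" and s :: "'v set \<Rightarrow> 'k::linorder"
  assumes bip: "bipartite_graph B I E" and inj: "inj_on s E"
    and mono: "\<And>e f. e \<in> E \<Longrightarrow> f \<in> E \<Longrightarrow> s e \<le> s f \<Longrightarrow> w e \<le> w f"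
    and nonneg: "\<And>e. e \<in> E \<Longrightarrow> 0 \<le> w e"
    and N: "N \<subseteq> E" "matching N"
  shows "weight w N \<le> 2 * weight w (greedy_matching E s)"
proof -
  let ?M = "greedy_matching E s"
  have fin: "finite E"
    using bip by (rule bipartite_graph_finite)
  have M: "?M \<subseteq> E" "\<And>e. e \<in> E \<Longrightarrow> e \<in> ?M \<longleftrightarrow> (\<forall>f\<in>?M. s e < s f \<longrightarrow> disjnt e f)"
    using greedy_matching_greedy(2)[OF fin inj] unfolding is_greedy_def by auto
  have two: "finite e \<and> card e = 2" if e: "e \<in> E" for e
  proof -
    obtain b i where "b \<in> B" "i \<notin> B" "e = {b, i}"
      using bipartite_graph_edge[OF bip e] by metis
    then show ?thesis
      by (auto simp: card_insert_if)
  qed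
  \<comment> \<open>Charges go to pairs of a greedy edge and one of its ends. The \<open>THE\<close>
    term recovers the charging edge from the end, which witnesses that the charging is
    injective.\<close>
  have "sum w N \<le> sum (\<lambda>(e, k). w e) (SIGMA e:?M. e)"
  proof (rule sum_le_included[where i = "\<lambda>(e, k). THE f. f \<in> N \<and> k \<in> f"])
    show "finite N"
      using N(1) fin finite_subset by blast
    show "finite (SIGMA e:?M. e)"
      using M(1) fin two finite_subset by blast
    show "\<forall>y\<in>SIGMA e:?M. e. 0 \<le> (case y of (e, k) \<Rightarrow> w e)"
      using M(1) nonneg by auto
    show "\<forall>f\<in>N. \<exists>y\<in>SIGMA e:?M. e. (case y of (e, k) \<Rightarrow> THE f. f \<in> N \<and> k \<in> f) = f
        \<and> w f \<le> (case y of (e, k) \<Rightarrow> w e)"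
    proof
      fix f
      assume f: "f \<in> N"
      then have "f \<in> E"
        using N(1) by blast
      obtain e k where ek: "e \<in> ?M" "k \<in> e" "k \<in> f" "s f \<le> s e"
      proof (cases "f \<in> ?M")
        case True
        moreover obtain k where "k \<in> f"
          using bipartite_graph_edge[OF bip \<open>f \<in> E\<close>] by blast
        ultimately show ?thesis
          using that by blast
      next
        case False
        then show ?thesis
          using M(2)[OF \<open>f \<in> E\<close>] that unfolding disjnt_def by force
      qed
      have "(THE f'. f' \<in> N \<and> k \<in> f') = f"
      proof (rule the_equality)
        show "f' = f" if "f' \<in> N \<and> k \<in> f'" for f'
          using matching_disjoint[OF N(2) _ f _ ek(3)] that by blast
      qed (use ek(3) f in simp)
      moreover have "w f \<le> w e"
        using mono \<open>f \<in> E\<close> ek M(1) by blast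
      ultimately show "\<exists>y\<in>SIGMA e:?M. e. (case y of (e, k) \<Rightarrow> THE f. f \<in> N \<and> k \<in> f) = f
          \<and> w f \<le> (case y of (e, k) \<Rightarrow> w e)"
        using ek by (intro bexI[of _ "(e, k)"]) auto
    qed
  qed
  also have "\<dots> = (\<Sum>e\<in>?M. \<Sum>k\<in>e. w e)"
    using M(1) fin two by (subst sum.Sigma) (auto intro: finite_subset)
  also have "\<dots> = 2 * sum w ?M"
    using M(1) two by (auto simp: sum_distrib_left intro!: sum.cong)
  finally show ?thesis
    unfolding weight_def .
qed

section \<open>Edges that are open when their larger draw is inspected\<close>

definition peak :: "('e \<Rightarrow> 'k::linorder) \<Rightarrow> ('e \<Rightarrow> 'k) \<Rightarrow> 'e \<Rightarrow> 'k" where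
  "peak s r e = max (s e) (r e)"

text \<open>Only edges of the sample matching that are settled strictly before the peak of
  \<open>e\<close> count. The sample of \<open>e\<close> itself never exceeds this peak, so an edge
  does not close itself.\<close>

definition open_edges ::
  "'v set set \<Rightarrow> ('v set \<Rightarrow> 'k::linorder) \<Rightarrow> ('v set \<Rightarrow> 'k) \<Rightarrow> 'v set set" where
  "open_edges E s r =
     {e \<in> E. \<forall>f\<in>greedy_matching E s. peak s r e < s f \<longrightarrow> disjnt e f}"

text \<open>Intersecting with \<open>B\<close> expresses that two edges share their buyer without
  naming that buyer; intersecting with \<open>I\<close> does the same for items below.\<close>

definition lead_edges ::
  "'v set \<Rightarrow> 'v set set \<Rightarrow> ('v set \<Rightarrow> 'k::linorder) \<Rightarrow> ('v set \<Rightarrow> 'k) \<Rightarrow> 'v set set" where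
  "lead_edges B E s r =
     {e \<in> open_edges E s r.
       \<forall>f\<in>open_edges E s r. e \<inter> f \<inter> B \<noteq> {} \<longrightarrow> peak s r f \<le> peak s r e}"

definition requests ::
  "'v set \<Rightarrow> 'v set set \<Rightarrow> ('v set \<Rightarrow> 'k::linorder) \<Rightarrow> ('v set \<Rightarrow> 'k) \<Rightarrow> 'v set set" where
  "requests B E s r = {e \<in> lead_edges B E s r. s e < r e}"

definition least_requests ::
  "'v set \<Rightarrow> 'v set \<Rightarrow> 'v set set \<Rightarrow> ('v set \<Rightarrow> 'k::linorder) \<Rightarrow> ('v set \<Rightarrow> 'k) \<Rightarrow> 'v set set" where
  "least_requests B I E s r =
     {e \<in> requests B E s r.
       \<forall>f\<in>requests B E s r. e \<inter> f \<inter> I \<noteq> {} \<longrightarrow> peak s r e \<le> peak s r f}"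

text \<open>The lead at the item of \<open>e\<close> that is inspected next after \<open>e\<close>.
  Encoding it as a set with at most one element covers the case that no such lead exists.\<close>

definition next_leads ::
  "'v set \<Rightarrow> 'v set \<Rightarrow> 'v set set \<Rightarrow> ('v set \<Rightarrow> 'k::linorder) \<Rightarrow> ('v set \<Rightarrow> 'k) \<Rightarrow>
   'v set \<Rightarrow> 'v set set" where
  "next_leads B I E s r e =
     {g \<in> lead_edges B E s r. e \<inter> g \<inter> I \<noteq> {} \<and> peak s r g < peak s r e \<and>
       (\<forall>h\<in>lead_edges B E s r. e \<inter> h \<inter> I \<noteq> {} \<and> peak s r h < peak s r e \<longrightarrow>
          peak s r h \<le> peak s r g)}"

text \<open>The deterministic analysis of a single realisation, over any value order. It is later
  applied to keys, whose ranks make all draws distinct even when the distributions have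
  atoms.\<close>

locale distinct_draws =
  fixes B I :: "'v set" and E :: "'v set set" and s r :: "'v set \<Rightarrow> 'k::{linorder,zero}"
  assumes bip: "bipartite_graph B I E"
    and inj_s: "inj_on s E" and inj_r: "inj_on r E"
    and neq: "\<And>e f. e \<in> E \<Longrightarrow> f \<in> E \<Longrightarrow> s e \<noteq> r f"
begin

abbreviation "SM \<equiv> greedy_matching E s"

lemma fin: "finite E"
  using bip by (rule bipartite_graph_finite)

lemma SM_sub: "SM \<subseteq> E"
  using greedy_matching_greedy(2)[OF fin inj_s] unfolding is_greedy_def by blast

lemma SM_iff: "e \<in> E \<Longrightarrow> e \<in> SM \<longleftrightarrow> (\<forall>f\<in>SM. s e < s f \<longrightarrow> disjnt e f)"
  using greedy_matching_greedy(2)[OF fin inj_s] unfolding is_greedy_def by blast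

lemma SM_unique: "e \<in> SM \<Longrightarrow> f \<in> SM \<Longrightarrow> k \<in> e \<Longrightarrow> k \<in> f \<Longrightarrow> e = f"
  using matching_disjoint[OF greedy_matching_greedy(1)[OF fin inj_s]] .

lemma peak_inj: "e \<in> E \<Longrightarrow> f \<in> E \<Longrightarrow> peak s r e = peak s r f \<Longrightarrow> e = f"
  using inj_onD[OF inj_s] inj_onD[OF inj_r] neq unfolding peak_def max_def
  by (metis (no_types))

lemma draw_cases: "e \<in> E \<Longrightarrow> s e < r e \<or> r e < s e"
  using neq by (meson linorder_neq_iff)

lemma open_sub: "open_edges E s r \<subseteq> E"
  and lead_sub: "lead_edges B E s r \<subseteq> open_edges E s r"
  and requests_sub: "requests B E s r \<subseteq> lead_edges B E s r"
  unfolding open_edges_def lead_edges_def requests_def by auto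

lemma same_end:
  assumes "e \<in> E" "k \<in> e" "k' \<in> e" "(k \<in> B \<and> k' \<in> B) \<or> (k \<in> I \<and> k' \<in> I)"
  shows "k = k'"
  using bipartite_graph_edge[OF bip assms(1)] assms(2-4) by auto

text \<open>Replacing the threshold \<open>s e\<close> by the larger peak only weakens the greedy
  criterion.\<close>

lemma SM_open: "SM \<subseteq> open_edges E s r"
  using SM_sub SM_iff unfolding open_edges_def peak_def by auto

text \<open>On tails the peak equals \<open>s e\<close>, so being open is the greedy criterion
  itself.\<close>

lemma open_tails_SM: "e \<in> open_edges E s r \<Longrightarrow> r e < s e \<Longrightarrow> e \<in> SM"
  using SM_iff unfolding open_edges_def peak_def by (auto simp: max_def split: if_splits)

lemma ex_lead:
  assumes "e \<in> open_edges E s r" "b \<in> e" "b \<in> B"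
  obtains f where "f \<in> lead_edges B E s r" "b \<in> f" "peak s r e \<le> peak s r f"
proof -
  let ?C = "{f \<in> open_edges E s r. b \<in> f}"
  have C: "finite ?C" "?C \<noteq> {}"
    using open_sub fin assms by (auto intro: finite_subset)
  then obtain f where f: "f \<in> ?C" and max: "\<And>h. h \<in> ?C \<Longrightarrow> peak s r h \<le> peak s r f"
    using arg_max_on_finite[where S = ?C and f = "peak s r"] by blast
  have "f \<in> lead_edges B E s r"
    unfolding lead_edges_def mem_Collect_eq
  proof (intro conjI ballI impI)
    show "f \<in> open_edges E s r"
      using f by simp
    fix h
    assume h: "h \<in> open_edges E s r" "f \<inter> h \<inter> B \<noteq> {}"
    then have "b \<in> h"
      using same_end[of f b] f assms(3) open_sub by blast
    then show "peak s r h \<le> peak s r f"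
      using max h by simp
  qed
  then show ?thesis
    using that f max assms by blast
qed

lemma lead_unique:
  assumes "e \<in> lead_edges B E s r" "f \<in> lead_edges B E s r" "b \<in> e" "b \<in> f" "b \<in> B"
  shows "e = f"
proof -
  have "peak s r e = peak s r f"
    using assms unfolding lead_edges_def by (auto intro!: antisym)
  then show ?thesis
    using peak_inj lead_sub open_sub assms by blast
qed

text \<open>A sample matching edge is open, so the lead of its buyer has at least its peak. Charging
  the edge to this lead is injective, because different matching edges have different
  buyers.\<close>

lemma sum_SM_le_sum_lead:
  fixes w v :: "'v set \<Rightarrow> real"
  assumes "\<And>e f. e \<in> E \<Longrightarrow> f \<in> E \<Longrightarrow> peak s r e \<le> peak s r f \<Longrightarrow> w e \<le> v f"
    and "\<And>e. e \<in> E \<Longrightarrow> 0 \<le> v e"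
  shows "sum w SM \<le> sum v (lead_edges B E s r)"
proof (rule sum_le_included[where i = "\<lambda>f. THE e. e \<in> SM \<and> e \<inter> f \<inter> B \<noteq> {}"])
  show "finite SM" "finite (lead_edges B E s r)"
    using SM_sub lead_sub open_sub fin by (meson finite_subset order_trans)+
  show "\<forall>y\<in>lead_edges B E s r. 0 \<le> v y"
    using assms(2) lead_sub open_sub by blast
  show "\<forall>x\<in>SM. \<exists>y\<in>lead_edges B E s r.
      (THE e. e \<in> SM \<and> e \<inter> y \<inter> B \<noteq> {}) = x \<and> w x \<le> v y"
  proof
    fix x
    assume x: "x \<in> SM"
    obtain b where b: "b \<in> B" "b \<in> x"
      using bipartite_graph_edge[OF bip] x SM_sub by blast
    obtain f where f: "f \<in> lead_edges B E s r" "b \<in> f" "peak s r x \<le> peak s r f"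
      using ex_lead[OF _ b(2,1)] x SM_open by blast
    have fE: "f \<in> E"
      using f(1) lead_sub open_sub by blast
    have "e = x" if "e \<in> SM" "e \<inter> f \<inter> B \<noteq> {}" for e
      using SM_unique[of e x b] same_end[OF fE f(2)] that x b by blast
    then have "(THE e. e \<in> SM \<and> e \<inter> f \<inter> B \<noteq> {}) = x"
      using x b f(2) by (intro the_equality) auto
    then show "\<exists>y\<in>lead_edges B E s r.
        (THE e. e \<in> SM \<and> e \<inter> y \<inter> B \<noteq> {}) = x \<and> w x \<le> v y"
      using assms(1)[of x f] f x fE SM_sub by blast
  qed
qed

text \<open>An open edge showing tails joins the sample matching with its peak as sample, and
  thereby closes every edge at its ends with a smaller peak.\<close>

lemma later_not_open:
  assumes "g \<in> open_edges E s r" "r g < s g" "k \<in> g" "k \<in> h" "peak s r h < peak s r g"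
  shows "h \<notin> open_edges E s r"
  using open_tails_SM[OF assms(1,2)] assms(2-5) unfolding open_edges_def
  by (auto simp: peak_def disjnt_def max_def split: if_splits)

lemma next_unique: "g \<in> next_leads B I E s r e \<Longrightarrow> h \<in> next_leads B I E s r e \<Longrightarrow> g = h"
  using peak_inj[of g h] lead_sub open_sub unfolding next_leads_def mem_Collect_eq
  by (metis antisym subsetD)

text \<open>A smaller request \<open>f\<close> at the item makes the set of later leads nonempty, so
  a next lead \<open>g\<close> exists. If \<open>g\<close> showed tails, it would close the item
  before \<open>f\<close> is inspected, although \<open>f\<close> is open.\<close>

lemma least_request_or_next:
  assumes "e \<in> requests B E s r" "e \<notin> least_requests B I E s r"
  shows "\<exists>g\<in>next_leads B I E s r e. s g < r g"
proof -
  let ?C = "{g \<in> lead_edges B E s r. e \<inter> g \<inter> I \<noteq> {} \<and> peak s r g < peak s r e}"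
  obtain f where f: "f \<in> requests B E s r" "e \<inter> f \<inter> I \<noteq> {}" "peak s r f < peak s r e"
    using assms unfolding least_requests_def mem_Collect_eq by (meson linorder_not_less)
  have C: "finite ?C" "f \<in> ?C"
    using f lead_sub open_sub requests_sub by (blast intro: finite_subset[OF _ fin])+
  then obtain g where g: "g \<in> ?C" and max: "\<And>h. h \<in> ?C \<Longrightarrow> peak s r h \<le> peak s r g"
    using arg_max_on_finite[where S = ?C and f = "peak s r"] by blast
  then have "g \<in> next_leads B I E s r e"
    using g unfolding next_leads_def by blast
  moreover have "s g < r g"
  proof (rule ccontr)
    assume "\<not> s g < r g"
    then have tails: "r g < s g"
      using g lead_sub open_sub draw_cases by blast
    then have "f \<noteq> g"
      using f(1) unfolding requests_def by auto
    then have "peak s r f < peak s r g"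
      using max[OF C(2)] peak_inj[of f g] g C(2) lead_sub open_sub by (auto simp: le_less)
    moreover obtain k where "k \<in> g" "k \<in> f"
    proof -
      obtain k k' where "k \<in> e" "k \<in> f" "k \<in> I" "k' \<in> e" "k' \<in> g" "k' \<in> I"
        using f(2) g by blast
      moreover have "e \<in> E"
        using assms(1) requests_sub lead_sub open_sub by blast
      ultimately show ?thesis
        using same_end[of e k k'] that by blast
    qed
    ultimately have "f \<notin> open_edges E s r"
      using later_not_open[of g] tails g lead_sub by blast
    then show False
      using C(2) lead_sub by blast
  qed
  ultimately show ?thesis
    by blast
qed

text \<open>The same blocking in the other direction: a smaller request at the item would differ
  from \<open>g\<close>, because it shows heads, and so would come after \<open>g\<close>, when the
  item is already closed.\<close>

lemma next_tails_least_request: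
  assumes "e \<in> requests B E s r" "g \<in> next_leads B I E s r e" "r g < s g"
  shows "e \<in> least_requests B I E s r"
proof -
  have "peak s r e \<le> peak s r f" if f: "f \<in> requests B E s r" "e \<inter> f \<inter> I \<noteq> {}" for f
  proof (rule ccontr)
    assume "\<not> peak s r e \<le> peak s r f"
    then have less: "peak s r f \<le> peak s r g"
      using f assms(2) requests_sub unfolding next_leads_def by auto
    have mem: "e \<in> E" "f \<in> E" "g \<in> E" "g \<in> open_edges E s r" "f \<in> open_edges E s r"
      using assms(1,2) f(1) requests_sub lead_sub open_sub unfolding next_leads_def by blast+
    have "f \<noteq> g"
      using f(1) assms(3) unfolding requests_def by auto
    then have "peak s r f < peak s r g"
      using less peak_inj[OF mem(2,3)] by (auto simp: le_less)
    moreover obtain k where "k \<in> g" "k \<in> f"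
    proof -
      obtain k k' where "k \<in> e" "k \<in> f" "k \<in> I" "k' \<in> e" "k' \<in> g" "k' \<in> I"
        using f(2) assms(2) unfolding next_leads_def by blast
      then show ?thesis
        using same_end[of e k k'] that mem(1) by blast
    qed
    ultimately show False
      using later_not_open[of g] assms(3) mem(4,5) by blast
  qed
  then show ?thesis
    using assms(1) unfolding least_requests_def by blast
qed

section \<open>The online algorithm\<close>

text \<open>At a matched vertex the price is the sample of the only matching edge there. At an
  unmatched vertex the right side is vacuous and the default price 0 passes by nonnegativity of
  \<open>x\<close>.\<close>

lemma price_le_iff:
  assumes "0 \<le> x"
  shows "price E s k \<le> x \<longleftrightarrow> (\<forall>f\<in>SM. k \<in> f \<longrightarrow> s f \<le> x)"
proof (cases "k \<in> \<Union>SM")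
  case True
  then obtain f where f: "f \<in> SM" "k \<in> f"
    by blast
  have uniq: "e = f" if "e \<in> SM" "k \<in> e" for e
    using SM_unique[OF that(1) f(1) that(2) f(2)] .
  then have "(THE e. e \<in> SM \<and> k \<in> e) = f"
    using f by (intro the_equality) (blast dest: uniq)+
  then have "price E s k = s f"
    using True unfolding price_def Let_def by simp
  then show ?thesis
    using f by (auto dest: uniq)
next
  case False
  then show ?thesis
    using assms unfolding price_def Let_def by auto
qed

text \<open>Passing the price test forces heads. On tails, \<open>e\<close> is not in the sample
  matching, since its own sample would then be a price above \<open>r e\<close>; but then it was
  blocked by a matching edge with an even larger sample, which is also a price at an end of
  \<open>e\<close>. On heads the peak is \<open>r e\<close>, and the price test says that
  \<open>e\<close> is open.\<close>

lemma eligible_iff: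
  assumes "\<And>e. e \<in> E \<Longrightarrow> 0 \<le> r e"
  shows "e \<in> eligible E s r b \<longleftrightarrow> b \<in> e \<and> e \<in> open_edges E s r \<and> s e < r e"
proof (cases "e \<in> E \<and> b \<in> e")
  case True
  then have e: "finite e" "e \<noteq> {}" "e \<in> E"
    using bipartite_graph_edge[OF bip, of e] by blast+
  have less: "s f \<le> r e \<longleftrightarrow> s f < r e" if "f \<in> SM" for f
    using neq[of f e] SM_sub that e(3) by (auto simp: le_less)
  have "e \<in> eligible E s r b \<longleftrightarrow> (\<forall>k\<in>e. price E s k \<le> r e)"
    using True e unfolding eligible_def by auto
  also have "\<dots> \<longleftrightarrow> (\<forall>f\<in>SM. \<not> disjnt e f \<longrightarrow> s f \<le> r e)"
    unfolding price_le_iff[OF assms[OF e(3)]] disjnt_def by blast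
  also have "\<dots> \<longleftrightarrow> (\<forall>f\<in>SM. \<not> disjnt e f \<longrightarrow> s f < r e)"
    using less by blast
  also have "\<dots> \<longleftrightarrow> e \<in> open_edges E s r \<and> s e < r e"
  proof
    assume *: "\<forall>f\<in>SM. \<not> disjnt e f \<longrightarrow> s f < r e"
    have "s e < r e"
    proof (rule ccontr)
      assume "\<not> s e < r e"
      then have "r e < s e"
        using draw_cases e(3) by blast
      moreover have "e \<notin> SM"
        using * e(2) \<open>\<not> s e < r e\<close> unfolding disjnt_def by auto
      ultimately show False
        using * SM_iff[OF e(3)] by (metis less_trans less_asym)
    qed
    then show "e \<in> open_edges E s r \<and> s e < r e"
      using * e(3) unfolding open_edges_def peak_def by (auto simp: max_def)
  next
    assume *: "e \<in> open_edges E s r \<and> s e < r e"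
    then have "peak s r e = r e"
      unfolding peak_def by simp
    then show "\<forall>f\<in>SM. \<not> disjnt e f \<longrightarrow> s f < r e"
      using * less unfolding open_edges_def by (auto simp: not_less[symmetric])
  qed
  finally show ?thesis
    using True by simp
next
  case False
  then show ?thesis
    using open_sub unfolding eligible_def by auto
qed

text \<open>Let \<open>f\<close> be the lead of \<open>b\<close>. If it showed tails, it would close
  the chosen edge, which has a smaller peak. So \<open>f\<close> shows heads and is eligible itself;
  maximality of reward and maximality of peak then identify the two edges.\<close>

lemma arg_max_eligible:
  assumes r: "\<And>e. e \<in> E \<Longrightarrow> 0 \<le> r e" and "b \<in> B" "eligible E s r b \<noteq> {}"
  shows "arg_max_on r (eligible E s r b) \<in> requests B E s r"
    "b \<in> arg_max_on r (eligible E s r b)"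
proof -
  let ?C = "eligible E s r b"
  let ?e = "arg_max_on r ?C"
  have "finite ?C"
    using fin unfolding eligible_def by simp
  then have e: "?e \<in> ?C" "\<And>f. f \<in> ?C \<Longrightarrow> r f \<le> r ?e"
    using arg_max_on_finite[where S = ?C and f = r] assms(3) by auto
  show "b \<in> ?e"
    using e(1) eligible_iff[OF r] by blast
  have "?e \<in> open_edges E s r" "s ?e < r ?e"
    using e(1) eligible_iff[OF r] by blast+
  obtain f where f: "f \<in> lead_edges B E s r" "b \<in> f" "peak s r ?e \<le> peak s r f"
    using ex_lead[OF \<open>?e \<in> open_edges E s r\<close> \<open>b \<in> ?e\<close> \<open>b \<in> B\<close>] by blast
  have "s f < r f"
  proof (rule ccontr)
    assume "\<not> s f < r f"
    then have tails: "r f < s f"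
      using f(1) lead_sub open_sub draw_cases by blast
    then have "f \<noteq> ?e"
      using \<open>s ?e < r ?e\<close> by auto
    then have "peak s r ?e < peak s r f"
      using f peak_inj lead_sub open_sub \<open>?e \<in> open_edges E s r\<close> by (metis le_less subsetD)
    then show False
      using later_not_open[of f b ?e] tails f lead_sub \<open>b \<in> ?e\<close> \<open>?e \<in> open_edges E s r\<close>
      by blast
  qed
  then have "f \<in> ?C"
    using f eligible_iff[OF r] lead_sub by blast
  then have "r f \<le> r ?e"
    by (rule e(2))
  then have "peak s r f = peak s r ?e"
    using f(3) \<open>s f < r f\<close> \<open>s ?e < r ?e\<close> unfolding peak_def by auto
  then have "f = ?e"
    using peak_inj f(1) lead_sub open_sub \<open>?e \<in> open_edges E s r\<close> by blast
  then show "?e \<in> requests B E s r"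
    using f(1) \<open>s ?e < r ?e\<close> unfolding requests_def by simp
qed

text \<open>A request is refused only if its item is already taken. So the arrival order influences
  which request an item receives, but every item requested by an arrived buyer ends up
  occupied.\<close>

lemma online_matching_requests:
  assumes r: "\<And>e. e \<in> E \<Longrightarrow> 0 \<le> r e" and "set bs \<subseteq> B"
  shows "online_matching E s r bs \<subseteq> requests B E s r \<and>
    (\<forall>e\<in>requests B E s r. e \<inter> set bs \<noteq> {} \<longrightarrow>
       (\<exists>f\<in>online_matching E s r bs. e \<inter> f \<inter> I \<noteq> {}))"
  using assms(2)
proof (induction bs rule: rev_induct)
  case Nil
  then show ?case
    by (simp add: online_matching_def)
next
  case (snoc b bs)
  let ?M = "online_matching E s r bs" and ?C = "eligible E s r b"
  let ?e = "arg_max_on r ?C"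
  have step: "online_matching E s r (bs @ [b]) =
      (if ?C \<noteq> {} \<and> (?e - {b}) \<inter> \<Union>?M = {} then insert ?e ?M else ?M)"
    unfolding online_matching_def by (simp add: arrival_step_def Let_def)
  have b: "b \<in> B"
    using snoc.prems by simp
  have IH: "?M \<subseteq> requests B E s r"
    "\<And>e. e \<in> requests B E s r \<Longrightarrow> e \<inter> set bs \<noteq> {} \<Longrightarrow> \<exists>f\<in>?M. e \<inter> f \<inter> I \<noteq> {}"
    using snoc by auto
  have "\<exists>f\<in>online_matching E s r (bs @ [b]). e \<inter> f \<inter> I \<noteq> {}"
    if e: "e \<in> requests B E s r" "b \<in> e" for e
  proof -
    have "e \<in> ?C"
      using e eligible_iff[OF r] lead_sub unfolding requests_def by blast
    then have C: "?C \<noteq> {}"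
      by blast
    \<comment> \<open>Both edges are leads at \<open>b\<close>, and a buyer has only one
      lead.\<close>
    have "e = ?e"
      using lead_unique[of e ?e b] arg_max_eligible[OF r b C] e b requests_sub by blast
    obtain i where i: "e = {b, i}" "i \<in> I"
      using bipartite_graph_edge[OF bip, of e] e b requests_sub lead_sub open_sub
      by (metis insertE singletonD subsetD)
    show ?thesis
    proof (cases "(?e - {b}) \<inter> \<Union>?M = {}")
      case True
      then show ?thesis
        using C i \<open>e = ?e\<close> unfolding step by auto
    next
      case False
      then show ?thesis
        using i \<open>e = ?e\<close> unfolding step by auto
    qed
  qed
  moreover have "?M \<subseteq> online_matching E s r (bs @ [b])"
    unfolding step by auto
  moreover have "online_matching E s r (bs @ [b]) \<subseteq> requests B E s r"
    using arg_max_eligible(1)[OF r b] IH(1) unfolding step by auto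
  ultimately show ?case
    using IH(2) by fastforce
qed

text \<open>The item of a least request is occupied by some request, whose reward is at least as
  large because on heads peaks are rewards. Distinct least requests have distinct items, so this
  charging is injective.\<close>

lemma sum_least_requests_le_online:
  fixes w v :: "'v set \<Rightarrow> real"
  assumes r: "\<And>e. e \<in> E \<Longrightarrow> 0 \<le> r e" and "set bs = B"
    and mono: "\<And>e f. e \<in> E \<Longrightarrow> f \<in> E \<Longrightarrow> s e < r e \<Longrightarrow> r e \<le> r f \<Longrightarrow> v e \<le> w f"
    and nonneg: "\<And>e. e \<in> E \<Longrightarrow> 0 \<le> w e"
  shows "sum v (least_requests B I E s r) \<le> weight w (online_matching E s r bs)"
  unfolding weight_def
proof (rule sum_le_included[where
      i = "\<lambda>f. THE e. e \<in> least_requests B I E s r \<and> e \<inter> f \<inter> I \<noteq> {}"])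
  let ?L = "least_requests B I E s r" and ?M = "online_matching E s r bs"
  have M: "?M \<subseteq> requests B E s r"
    "\<And>e. e \<in> requests B E s r \<Longrightarrow> e \<inter> B \<noteq> {} \<Longrightarrow> \<exists>f\<in>?M. e \<inter> f \<inter> I \<noteq> {}"
    using online_matching_requests[OF r, of bs] assms(2) by auto
  have R: "requests B E s r \<subseteq> E"
    using requests_sub lead_sub open_sub by blast
  have L: "?L \<subseteq> requests B E s r"
    unfolding least_requests_def by auto
  show "finite ?L" "finite ?M"
    using M(1) R L fin by (meson finite_subset order_trans)+
  show "\<forall>y\<in>?M. 0 \<le> w y"
    using M(1) R nonneg by blast
  show "\<forall>x\<in>?L. \<exists>y\<in>?M. (THE e. e \<in> ?L \<and> e \<inter> y \<inter> I \<noteq> {}) = x \<and> v x \<le> w y"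
  proof
    fix x
    assume x: "x \<in> ?L"
    then have xR: "x \<in> requests B E s r" "x \<in> E"
      using L R by auto
    obtain y where y: "y \<in> ?M" "x \<inter> y \<inter> I \<noteq> {}"
      using M(2)[OF xR(1)] bipartite_graph_edge[OF bip xR(2)] by blast
    have yR: "y \<in> requests B E s r" "y \<in> E"
      using y M(1) R by auto
    have "peak s r x \<le> peak s r y"
      using x y(2) yR(1) unfolding least_requests_def by blast
    then have "r x \<le> r y"
      using xR(1) yR(1) unfolding requests_def peak_def by auto
    then have "v x \<le> w y"
      using mono xR yR unfolding requests_def by blast
    moreover have "(THE e. e \<in> ?L \<and> e \<inter> y \<inter> I \<noteq> {}) = x"
    proof (rule the_equality)
      fix e
      assume e: "e \<in> ?L \<and> e \<inter> y \<inter> I \<noteq> {}"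
      \<comment> \<open>The edge \<open>y\<close> has only one end in \<open>I\<close>, so
        \<open>e\<close> and \<open>x\<close> meet there; minimality of each against the other then
        gives equal peaks.\<close>
      then have "e \<inter> x \<inter> I \<noteq> {}"
        using same_end[OF yR(2)] y(2) by blast
      then have "peak s r e = peak s r x"
        using e x L unfolding least_requests_def by (auto intro!: antisym)
      then show "e = x"
        using peak_inj e L R xR(2) by blast
    qed (use x y in auto)
    ultimately show "\<exists>y\<in>?M. (THE e. e \<in> ?L \<and> e \<inter> y \<inter> I \<noteq> {}) = x \<and> v x \<le> w y"
      using y(1) by blast
  qed
qed

section \<open>Exchanging the two draws of an edge\<close>

abbreviation swap_s :: "'v set \<Rightarrow> 'v set \<Rightarrow> 'k" where "swap_s g \<equiv> s(g := r g)"
abbreviation swap_r :: "'v set \<Rightarrow> 'v set \<Rightarrow> 'k" where "swap_r g \<equiv> r(g := s g)"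

lemma swap: "g \<in> E \<Longrightarrow> distinct_draws B I E (swap_s g) (swap_r g)"
  using bip inj_s inj_r neq
  by unfold_locales (auto simp: inj_on_def dest: neq[THEN not_sym])

lemma peak_swap [simp]: "peak (swap_s g) (swap_r g) = peak s r"
  by (auto simp: peak_def max.commute fun_eq_iff)

text \<open>Both draws of \<open>g\<close> are at most the peak of \<open>e\<close>. The exchange
  therefore leaves all samples above this threshold alone, and by locality also the part of the
  sample matching above it. The case \<open>e = g\<close> is included.\<close>

lemma open_swap:
  assumes "g \<in> E" "peak s r g \<le> peak s r e"
  shows "e \<in> open_edges E (swap_s g) (swap_r g) \<longleftrightarrow> e \<in> open_edges E s r"
proof -
  interpret sw: distinct_draws B I E "swap_s g" "swap_r g"
    using assms(1) by (rule swap)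
  have g: "s g \<le> peak s r e" "r g \<le> peak s r e"
    using assms(2) by (simp_all add: peak_def)
  have eq: "s f = swap_s g f" if "peak s r e < s f \<or> peak s r e < swap_s g f" for f
    using that g by (auto simp: not_less[symmetric] split: if_splits)
  have "f \<in> SM \<longleftrightarrow> f \<in> sw.SM" if "f \<in> E" "peak s r e < s f" for f
  proof (rule is_greedy_agree[OF fin greedy_matching_greedy(2)[OF fin inj_s]
        greedy_matching_greedy(2)[OF fin sw.inj_s] that(1)])
    fix h
    assume "s f \<le> s h \<or> s f \<le> swap_s g h"
    then have "peak s r e < s h \<or> peak s r e < swap_s g h"
      using that(2) by (meson less_le_trans)
    then show "s h = swap_s g h"
      by (rule eq)
  qed
  then have "f \<in> SM \<and> peak s r e < s f \<longleftrightarrow> f \<in> sw.SM \<and> peak s r e < swap_s g f" for f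
    using eq[of f] SM_sub sw.SM_sub by (metis subsetD)
  then have "(\<forall>f\<in>SM. peak s r e < s f \<longrightarrow> disjnt e f) \<longleftrightarrow>
      (\<forall>f\<in>sw.SM. peak s r e < swap_s g f \<longrightarrow> disjnt e f)"
    by blast
  then show ?thesis
    unfolding open_edges_def by simp
qed

text \<open>Only open edges with a larger peak than \<open>e\<close> can prevent \<open>e\<close>
  from being a lead, and the openness of those is unaffected as well.\<close>

lemma lead_swap:
  assumes "g \<in> E" "peak s r g \<le> peak s r e"
  shows "e \<in> lead_edges B E (swap_s g) (swap_r g) \<longleftrightarrow> e \<in> lead_edges B E s r"
proof -
  have "f \<in> open_edges E (swap_s g) (swap_r g) \<longleftrightarrow> f \<in> open_edges E s r"
    if "\<not> peak s r f \<le> peak s r e" for f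
    using open_swap[OF assms(1)] that assms(2) by auto
  then show ?thesis
    using open_swap[OF assms] unfolding lead_edges_def peak_swap by blast
qed

text \<open>Whether \<open>g\<close> comes next depends on \<open>g\<close> being a lead and on the
  leads with peaks above that of \<open>g\<close>. None of this sees the coin of
  \<open>g\<close>.\<close>

lemma next_swap:
  assumes "g \<in> E"
  shows "g \<in> next_leads B I E (swap_s g) (swap_r g) e \<longleftrightarrow> g \<in> next_leads B I E s r e"
proof -
  have "f \<in> lead_edges B E (swap_s g) (swap_r g) \<longleftrightarrow> f \<in> lead_edges B E s r"
    if "\<not> peak s r f \<le> peak s r g" for f
    using lead_swap[OF assms] that by auto
  then show ?thesis
    using lead_swap[OF assms order_refl] unfolding next_leads_def peak_swap by blast
qed

text \<open>The strict inequality makes \<open>e\<close> and \<open>g\<close> different, so the coin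
  of \<open>e\<close> is kept.\<close>

lemma requests_swap:
  assumes "g \<in> E" "peak s r g < peak s r e"
  shows "e \<in> requests B E (swap_s g) (swap_r g) \<longleftrightarrow> e \<in> requests B E s r"
proof -
  have "e \<noteq> g"
    using assms(2) by auto
  then show ?thesis
    using lead_swap[OF assms(1) less_imp_le[OF assms(2)]] unfolding requests_def by simp
qed

end

section \<open>Symmetries of the random experiment\<close>

text \<open>A singleton \<open>A\<close> flips the coin of one edge; \<open>UNIV\<close>
  interchanges the roles of all samples and all rewards.\<close>

definition exchange :: "'e set \<Rightarrow> 'e draw \<Rightarrow> 'e draw" where
  "exchange A x =
     (case x of Reward e \<Rightarrow> if e \<in> A then Sample e else Reward e
      | Sample e \<Rightarrow> if e \<in> A then Reward e else Sample e)"

text \<open>Ranks travel together with values, so that whole keys are exchanged.\<close>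

definition exchange_draws :: "'e set \<Rightarrow> 'e outcome \<Rightarrow> 'e outcome" where
  "exchange_draws A \<omega> = (fst \<omega> \<circ> exchange A, snd \<omega> \<circ> exchange A)"

lemma exchange_invol [simp]: "exchange A (exchange A x) = x"
  by (auto simp: exchange_def split: draw.splits)

lemma drawn_edge_exchange [simp]: "drawn_edge (exchange A x) = drawn_edge x"
  by (auto simp: exchange_def split: draw.splits)

lemma draws_iff: "x \<in> draws E \<longleftrightarrow> drawn_edge x \<in> E"
  by (cases x) (auto simp: draws_def)

lemma exchange_in_draws [simp]: "exchange A x \<in> draws E \<longleftrightarrow> x \<in> draws E"
  by (simp add: draws_iff)

lemma bij_betw_exchange: "bij_betw (exchange A) (draws E) (draws E)"
  by (rule bij_betwI[where g = "exchange A"]) auto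

lemma finite_rankings: "finite A \<Longrightarrow> finite (rankings A)"
  unfolding rankings_def by (rule finite_subset[OF _ finite_PiE[of A "\<lambda>_. {..<card A}"]]) auto

lemma rankings_nonempty: "finite A \<Longrightarrow> rankings A \<noteq> {}"
proof -
  assume "finite A"
  then obtain h where h: "bij_betw h A {..<card A}"
    using ex_bij_betw_finite_nat[of A] by (auto simp: atLeast0LessThan)
  then have "restrict h A \<in> rankings A"
    unfolding rankings_def by (auto simp: bij_betw_def inj_on_def)
  then show ?thesis
    by blast
qed

lemma exchange_rankings: "\<tau> \<in> rankings (draws E) \<Longrightarrow> \<tau> \<circ> exchange A \<in> rankings (draws E)"
  unfolding rankings_def
  by (auto simp: PiE_def extensional_def intro!: bij_betw_trans[OF bij_betw_exchange])

lemma distr_uniform_count_measure: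
  assumes "finite A" "bij_betw f A A"
  shows "distr (uniform_count_measure A) (uniform_count_measure A) f = uniform_count_measure A"
proof (rule measure_eqI)
  have meas: "f \<in> uniform_count_measure A \<rightarrow>\<^sub>M uniform_count_measure A"
    using assms(2) by (auto simp: measurable_def sets_uniform_count_measure
        space_uniform_count_measure bij_betw_def)
  fix X
  assume "X \<in> sets (distr (uniform_count_measure A) (uniform_count_measure A) f)"
  then have X: "X \<subseteq> A"
    by (simp add: sets_uniform_count_measure)
  have "f ` (f -` X \<inter> A) = f ` A \<inter> X"
    by auto
  also have "\<dots> = X"
    using X bij_betw_imp_surj_on[OF assms(2)] by auto
  finally have "bij_betw f (f -` X \<inter> A) X"
    by (rule bij_betw_subset[OF assms(2) Int_lower2])
  then have "card (f -` X \<inter> A) = card X"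
    by (rule bij_betw_same_card)
  then show "emeasure (distr (uniform_count_measure A) (uniform_count_measure A) f) X =
      emeasure (uniform_count_measure A) X"
    using X assms(1) meas
    by (simp add: emeasure_distr emeasure_uniform_count_measure sets_uniform_count_measure
        space_uniform_count_measure)
qed simp

lemma key_value_mono: "x \<le> y \<Longrightarrow> key_value x \<le> key_value y"
  by (auto simp: less_eq_key_def)

lemma pred_key_less:
  assumes [measurable]: "f \<in> borel_measurable M" "g \<in> borel_measurable M"
    and m: "m \<in> M \<rightarrow>\<^sub>M count_space UNIV" and n: "n \<in> M \<rightarrow>\<^sub>M count_space UNIV"
  shows "Measurable.pred M (\<lambda>\<omega>. Key (f \<omega>) (m \<omega>) < Key (g \<omega>) (n \<omega>))"
proof -
  \<comment> \<open>Splitting over the countably many values of the first rank reduces the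
    comparison to events about a single rank.\<close>
  have "(\<lambda>\<omega>. m \<omega> < n \<omega>) = (\<lambda>\<omega>. \<exists>k. m \<omega> = k \<and> k < n \<omega>)"
    by simp
  also have "Measurable.pred M \<dots>"
    by (intro pred_intros_countable pred_intros_logic measurable_compose[OF m]
        measurable_compose[OF n] measurable_count_space)
  finally have [measurable]: "Measurable.pred M (\<lambda>\<omega>. m \<omega> < n \<omega>)" .
  show ?thesis
    unfolding less_key_def key.sel by measurable
qed

section \<open>The probability space and its invariance under exchanges\<close>

locale random_draws =
  fixes B I :: "'v set" and E :: "'v set set" and D :: "'v set \<Rightarrow> real measure"
  assumes bip: "bipartite_graph B I E"
    and prob_D: "\<And>e. e \<in> E \<Longrightarrow> prob_space (D e)"
    and sets_D: "\<And>e. e \<in> E \<Longrightarrow> sets (D e) = sets borel"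
    and nonneg_D: "\<And>e. e \<in> E \<Longrightarrow> AE x in D e. 0 \<le> x"
begin

abbreviation "\<Omega> \<equiv> outcomes E D"
abbreviation "vals \<equiv> \<Pi>\<^sub>M x\<in>draws E. D (drawn_edge x)"
abbreviation "ranks \<equiv> uniform_count_measure (rankings (draws E))"

lemma fin: "finite E" "finite (draws E)"
  using bipartite_graph_finite[OF bip] by (auto simp: draws_def)

lemma prob_values: "prob_space vals"
  using prob_D by (intro prob_space_PiM) (simp add: draws_iff)

lemma prob_ranks: "prob_space ranks"
  using fin(2) by (intro prob_space_uniform_count_measure finite_rankings rankings_nonempty)

text \<open>The two draws of an edge are independent with the same distribution, and permuting the
  draws maps the uniform ranking to a uniform ranking. Hence each factor of the product is
  preserved.\<close>

lemma exchange_draws_measurable [measurable]: "exchange_draws A \<in> \<Omega> \<rightarrow>\<^sub>M \<Omega>"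
  and distr_exchange_draws: "distr \<Omega> \<Omega> (exchange_draws A) = \<Omega>"
proof -
  interpret V: prob_space vals by (rule prob_values)
  interpret R: prob_space ranks by (rule prob_ranks)
  let ?v = "\<lambda>x. \<lambda>n\<in>draws E. x (exchange A n)" and ?r = "\<lambda>\<tau>. \<tau> \<circ> exchange A"
  have v: "distr vals vals ?v = vals"
    using distr_PiM_reindex[of "draws E" "\<lambda>x. D (drawn_edge x)" "exchange A" "draws E"] prob_D
    by (simp add: draws_iff inj_on_def) (metis exchange_invol)
  have v_meas: "?v \<in> vals \<rightarrow>\<^sub>M vals"
  proof (rule measurable_restrict)
    fix n
    assume "n \<in> draws E"
    then show "(\<lambda>x. x (exchange A n)) \<in> vals \<rightarrow>\<^sub>M D (drawn_edge n)"
      using measurable_component_singleton[of "exchange A n" "draws E" "\<lambda>x. D (drawn_edge x)"]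
      by simp
  qed
  have bij: "bij_betw ?r (rankings (draws E)) (rankings (draws E))"
    by (rule bij_betwI[where g = ?r]) (auto simp: exchange_rankings fun_eq_iff)
  have r: "distr ranks ranks ?r = ranks"
    using fin(2) bij by (intro distr_uniform_count_measure finite_rankings)
  have r_meas: "?r \<in> ranks \<rightarrow>\<^sub>M ranks"
    using exchange_rankings by (auto simp: measurable_def sets_uniform_count_measure
        space_uniform_count_measure)
  \<comment> \<open>Value functions in the product space are extensional and \<open>exchange\<close>
    maps \<open>draws E\<close> to itself, so plain composition agrees with the restricted
    reindexing.\<close>
  have eq: "exchange_draws A \<omega> = (case \<omega> of (x, \<tau>) \<Rightarrow> (?v x, ?r \<tau>))" if "\<omega> \<in> space \<Omega>" for \<omega>
  proof -
    have "fst \<omega> \<in> extensional (draws E)"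
      using that unfolding outcomes_def by (auto simp: space_pair_measure space_PiM PiE_def)
    then have "fst \<omega> \<circ> exchange A = ?v (fst \<omega>)"
      by (auto simp: fun_eq_iff extensional_def)
    then show ?thesis
      by (simp add: exchange_draws_def split_beta)
  qed
  have "(\<lambda>(x, \<tau>). (?v x, ?r \<tau>)) \<in> \<Omega> \<rightarrow>\<^sub>M \<Omega>"
    unfolding outcomes_def split_beta
    by (intro measurable_Pair measurable_compose[OF measurable_fst v_meas]
        measurable_compose[OF measurable_snd r_meas])
  then show "exchange_draws A \<in> \<Omega> \<rightarrow>\<^sub>M \<Omega>"
    by (subst measurable_cong[OF eq])
  have "distr \<Omega> \<Omega> (exchange_draws A) = distr \<Omega> \<Omega> (\<lambda>(x, \<tau>). (?v x, ?r \<tau>))"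
    using eq by (intro distr_cong) auto
  also have "\<dots> = distr vals vals ?v \<Otimes>\<^sub>M distr ranks ranks ?r"
    unfolding outcomes_def using r R.sigma_finite_measure_axioms
    by (intro pair_measure_distr[symmetric] v_meas r_meas) simp
  finally show "distr \<Omega> \<Omega> (exchange_draws A) = \<Omega>"
    unfolding v r outcomes_def .
qed

lemma nn_integral_exchange:
  "f \<in> borel_measurable \<Omega> \<Longrightarrow> (\<integral>\<^sup>+\<omega>. f (exchange_draws A \<omega>) \<partial>\<Omega>) = (\<integral>\<^sup>+\<omega>. f \<omega> \<partial>\<Omega>)"
  using nn_integral_distr[OF exchange_draws_measurable, of f A] by (simp add: distr_exchange_draws)

lemma value_measurable [measurable]: "x \<in> draws E \<Longrightarrow> (\<lambda>\<omega>. fst \<omega> x) \<in> borel_measurable \<Omega>"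
proof -
  assume x: "x \<in> draws E"
  have "(\<lambda>v. v x) \<in> vals \<rightarrow>\<^sub>M D (drawn_edge x)"
    using measurable_component_singleton[OF x, of "\<lambda>x. D (drawn_edge x)"] .
  moreover have "vals \<rightarrow>\<^sub>M D (drawn_edge x) = borel_measurable vals"
    using sets_D x by (intro measurable_cong_sets) (auto simp: draws_iff)
  ultimately have "(\<lambda>v. v x) \<in> borel_measurable vals"
    by blast
  then show ?thesis
    unfolding outcomes_def by (rule measurable_compose[OF measurable_fst])
qed

lemma rank_measurable [measurable]: "(\<lambda>\<omega>. snd \<omega> x) \<in> \<Omega> \<rightarrow>\<^sub>M count_space UNIV"
proof -
  have "(\<lambda>\<tau>. \<tau> x) \<in> ranks \<rightarrow>\<^sub>M count_space UNIV"
    by (auto simp: measurable_def sets_uniform_count_measure space_uniform_count_measure)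
  then show ?thesis
    unfolding outcomes_def by (rule measurable_compose[OF measurable_snd])
qed

lemma Reward_Sample_draws [simp]: "e \<in> E \<Longrightarrow> Reward e \<in> draws E" "e \<in> E \<Longrightarrow> Sample e \<in> draws E"
  by (auto simp: draws_iff)

lemma key_less_measurable [measurable]:
  assumes "x \<in> draws E" "y \<in> draws E"
  shows "Measurable.pred \<Omega> (\<lambda>\<omega>. Key (fst \<omega> x) (snd \<omega> x) < Key (fst \<omega> y) (snd \<omega> y))"
  using assms by (intro pred_key_less value_measurable rank_measurable)

section \<open>Distinctness of the keys and measurability of the events\<close>

abbreviation "greedy \<omega> \<equiv> greedy_matching E (sample_key \<omega>)"
abbreviation "lead \<omega> \<equiv> lead_edges B E (sample_key \<omega>) (reward_key \<omega>)"
abbreviation "request \<omega> \<equiv> requests B E (sample_key \<omega>) (reward_key \<omega>)"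
abbreviation "least \<omega> \<equiv> least_requests B I E (sample_key \<omega>) (reward_key \<omega>)"
abbreviation "succ \<omega> \<equiv> next_leads B I E (sample_key \<omega>) (reward_key \<omega>)"
abbreviation "heads \<omega> e \<equiv> sample_key \<omega> e < reward_key \<omega> e"

lemma ranks_inj: "\<omega> \<in> space \<Omega> \<Longrightarrow> inj_on (snd \<omega>) (draws E)"
  unfolding outcomes_def rankings_def
  by (auto simp: space_pair_measure space_uniform_count_measure bij_betw_def)

text \<open>Ranks are injective in every outcome, so this holds everywhere and not just almost
  surely.\<close>

lemma distinct:
  assumes "\<omega> \<in> space \<Omega>"
  shows "distinct_draws B I E (sample_key \<omega>) (reward_key \<omega>)"
proof
  have rank: "snd \<omega> x = snd \<omega> y \<longleftrightarrow> x = y" if "x \<in> draws E" "y \<in> draws E" for x y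
    using inj_on_eq_iff[OF ranks_inj[OF assms]] that by blast
  show "bipartite_graph B I E"
    by (rule bip)
  show "inj_on (sample_key \<omega>) E" "inj_on (reward_key \<omega>) E"
    by (auto simp: inj_on_def sample_key_def reward_key_def rank)
  show "sample_key \<omega> e \<noteq> reward_key \<omega> f" if "e \<in> E" "f \<in> E" for e f
    using that by (simp add: sample_key_def reward_key_def rank)
qed

lemma keys_exchange [simp]:
  "sample_key (exchange_draws {g} \<omega>) = (sample_key \<omega>)(g := reward_key \<omega> g)"
  "reward_key (exchange_draws {g} \<omega>) = (reward_key \<omega>)(g := sample_key \<omega> g)"
  "sample_key (exchange_draws UNIV \<omega>) = reward_key \<omega>"
  by (auto simp: fun_eq_iff sample_key_def reward_key_def exchange_draws_def exchange_def)

lemma sample_less_measurable [measurable]: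
  assumes [simp]: "e \<in> E" "f \<in> E"
  shows "Measurable.pred \<Omega> (\<lambda>\<omega>. sample_key \<omega> e < sample_key \<omega> f)"
    "Measurable.pred \<Omega> (\<lambda>\<omega>. reward_key \<omega> e < sample_key \<omega> f)"
    "Measurable.pred \<Omega> (\<lambda>\<omega>. sample_key \<omega> e < reward_key \<omega> f)"
    "Measurable.pred \<Omega> (\<lambda>\<omega>. reward_key \<omega> e < reward_key \<omega> f)"
  unfolding sample_key_def reward_key_def by measurable

lemma peak_less_sample_measurable [measurable]:
  assumes [measurable]: "e \<in> E" "f \<in> E"
  shows "Measurable.pred \<Omega> (\<lambda>\<omega>. peak (sample_key \<omega>) (reward_key \<omega>) e < sample_key \<omega> f)"
  unfolding peak_def max_less_iff_conj by measurable

lemma peak_less_measurable [measurable]: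
  assumes [measurable]: "e \<in> E" "f \<in> E"
  shows "Measurable.pred \<Omega> (\<lambda>\<omega>. peak (sample_key \<omega>) (reward_key \<omega>) e
      < peak (sample_key \<omega>) (reward_key \<omega>) f)"
  unfolding peak_def max_less_iff_conj less_max_iff_disj by measurable

text \<open>The \<open>SOME\<close> in the greedy matching gives no direct access to measurability.
  By uniqueness, membership becomes a finite disjunction over candidate sets satisfying
  \<open>is_greedy\<close>.\<close>

lemma greedy_measurable [measurable]: "Measurable.pred \<Omega> (\<lambda>\<omega>. e \<in> greedy \<omega>)"
proof -
  have "e \<in> greedy \<omega> \<longleftrightarrow> (\<exists>M\<in>Pow E. is_greedy E (sample_key \<omega>) M \<and> e \<in> M)" (is "_ \<longleftrightarrow> ?R \<omega>")
    if "\<omega> \<in> space \<Omega>" for \<omega>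
  proof -
    interpret distinct_draws B I E "sample_key \<omega>" "reward_key \<omega>"
      using that by (rule distinct)
    show ?thesis
      using greedy_matching_greedy(2)[OF fin inj_s] is_greedy_unique[OF fin] SM_sub by blast
  qed
  moreover have "Measurable.pred \<Omega> ?R"
  proof (intro pred_intros_finite pred_intros_logic)
    show "finite (Pow E)"
      using fin by simp
    fix M
    assume "M \<in> Pow E"
    then have M: "M \<subseteq> E" "finite M"
      using fin finite_subset by auto
    have "Measurable.pred \<Omega> (\<lambda>\<omega>. \<forall>e\<in>E. e \<in> M \<longleftrightarrow>
        (\<forall>f\<in>M. sample_key \<omega> e < sample_key \<omega> f \<longrightarrow> disjnt e f))"
      using M fin by (intro pred_intros_finite pred_intros_logic sample_less_measurable) auto
    then show "Measurable.pred \<Omega> (\<lambda>\<omega>. is_greedy E (sample_key \<omega>) M)"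
      unfolding is_greedy_def using M by simp
  qed auto
  ultimately show ?thesis
    by (subst measurable_cong) auto
qed

lemma open_measurable [measurable]:
  assumes "e \<in> E"
  shows "Measurable.pred \<Omega> (\<lambda>\<omega>. e \<in> open_edges E (sample_key \<omega>) (reward_key \<omega>))"
proof -
  have "e \<in> open_edges E (sample_key \<omega>) (reward_key \<omega>) \<longleftrightarrow>
      (\<forall>f\<in>E. f \<in> greedy \<omega> \<longrightarrow> peak (sample_key \<omega>) (reward_key \<omega>) e < sample_key \<omega> f \<longrightarrow> disjnt e f)"
    if "\<omega> \<in> space \<Omega>" for \<omega>
    using distinct_draws.SM_sub[OF distinct[OF that]] assms unfolding open_edges_def by blast
  moreover have "Measurable.pred \<Omega> (\<lambda>\<omega>. \<forall>f\<in>E. f \<in> greedy \<omega> \<longrightarrow>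
      peak (sample_key \<omega>) (reward_key \<omega>) e < sample_key \<omega> f \<longrightarrow> disjnt e f)"
    using fin assms
    by (intro pred_intros_finite pred_intros_logic greedy_measurable peak_less_sample_measurable) auto
  ultimately show ?thesis
    by (subst measurable_cong) auto
qed

lemma lead_measurable [measurable]:
  assumes "e \<in> E"
  shows "Measurable.pred \<Omega> (\<lambda>\<omega>. e \<in> lead \<omega>)"
proof -
  have "(\<lambda>\<omega>. e \<in> lead \<omega>) = (\<lambda>\<omega>. e \<in> open_edges E (sample_key \<omega>) (reward_key \<omega>) \<and>
      (\<forall>f\<in>E. f \<in> open_edges E (sample_key \<omega>) (reward_key \<omega>) \<longrightarrow> e \<inter> f \<inter> B \<noteq> {} \<longrightarrow>
        \<not> peak (sample_key \<omega>) (reward_key \<omega>) e < peak (sample_key \<omega>) (reward_key \<omega>) f))"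
    unfolding lead_edges_def by (auto simp: open_edges_def not_less fun_eq_iff)
  also have "Measurable.pred \<Omega> \<dots>"
    using fin assms by (intro pred_intros_finite pred_intros_logic open_measurable
        peak_less_measurable) auto
  finally show ?thesis .
qed

lemma request_measurable [measurable]:
  assumes [measurable]: "e \<in> E"
  shows "Measurable.pred \<Omega> (\<lambda>\<omega>. e \<in> request \<omega>)"
  unfolding requests_def mem_Collect_eq by measurable

lemma least_measurable [measurable]:
  assumes "e \<in> E"
  shows "Measurable.pred \<Omega> (\<lambda>\<omega>. e \<in> least \<omega>)"
proof -
  have "(\<lambda>\<omega>. e \<in> least \<omega>) = (\<lambda>\<omega>. e \<in> request \<omega> \<and>
      (\<forall>f\<in>E. f \<in> request \<omega> \<longrightarrow> e \<inter> f \<inter> I \<noteq> {} \<longrightarrow>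
        \<not> peak (sample_key \<omega>) (reward_key \<omega>) f < peak (sample_key \<omega>) (reward_key \<omega>) e))"
    unfolding least_requests_def
    by (auto simp: open_edges_def lead_edges_def requests_def not_less fun_eq_iff)
  also have "Measurable.pred \<Omega> \<dots>"
    using fin assms by (intro pred_intros_finite pred_intros_logic request_measurable
        peak_less_measurable) auto
  finally show ?thesis .
qed

lemma succ_measurable [measurable]:
  assumes "e \<in> E" "g \<in> E"
  shows "Measurable.pred \<Omega> (\<lambda>\<omega>. g \<in> succ \<omega> e)"
proof -
  have "(\<lambda>\<omega>. g \<in> succ \<omega> e) = (\<lambda>\<omega>. g \<in> lead \<omega> \<and> e \<inter> g \<inter> I \<noteq> {} \<and>
      peak (sample_key \<omega>) (reward_key \<omega>) g < peak (sample_key \<omega>) (reward_key \<omega>) e \<and>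
      (\<forall>f\<in>E. f \<in> lead \<omega> \<longrightarrow> e \<inter> f \<inter> I \<noteq> {} \<longrightarrow>
        peak (sample_key \<omega>) (reward_key \<omega>) f < peak (sample_key \<omega>) (reward_key \<omega>) e \<longrightarrow>
        \<not> peak (sample_key \<omega>) (reward_key \<omega>) g < peak (sample_key \<omega>) (reward_key \<omega>) f))"
    unfolding next_leads_def
    by (auto simp: open_edges_def lead_edges_def not_less fun_eq_iff)
  also have "Measurable.pred \<Omega> \<dots>"
    using fin assms by (intro pred_intros_finite pred_intros_logic lead_measurable
        peak_less_measurable) auto
  finally show ?thesis .
qed

section \<open>Comparison of expected weights\<close>

definition gain :: "'v set outcome \<Rightarrow> 'v set \<Rightarrow> ennreal" where
  "gain \<omega> e = ennreal (key_value (peak (sample_key \<omega>) (reward_key \<omega>) e))"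

lemma gain_measurable [measurable]: "e \<in> E \<Longrightarrow> (\<lambda>\<omega>. gain \<omega> e) \<in> borel_measurable \<Omega>"
proof -
  assume [simp]: "e \<in> E"
  have "gain \<omega> e = ennreal (max (fst \<omega> (Sample e)) (fst \<omega> (Reward e)))" for \<omega>
    by (auto simp: gain_def peak_def max_def sample_key_def reward_key_def less_eq_key_def)
  then show ?thesis
    by simp
qed

text \<open>Exchanging the draws of \<open>e\<close> preserves its being a lead and its gain but
  flips its coin. So a lead is requested in exactly one of the two outcomes, which have the same
  distribution.\<close>

lemma lead_le_request:
  assumes e: "e \<in> E"
  shows "(\<integral>\<^sup>+\<omega>. (if e \<in> lead \<omega> then gain \<omega> e else 0) \<partial>\<Omega>)
    \<le> 2 * (\<integral>\<^sup>+\<omega>. (if e \<in> request \<omega> then gain \<omega> e else 0) \<partial>\<Omega>)"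
proof -
  note [measurable] = e
  let ?h = "\<lambda>\<omega>. if e \<in> request \<omega> then gain \<omega> e else 0"
  have h [measurable]: "?h \<in> borel_measurable \<Omega>"
    by measurable
  have "(\<integral>\<^sup>+\<omega>. (if e \<in> lead \<omega> then gain \<omega> e else 0) \<partial>\<Omega>)
      \<le> (\<integral>\<^sup>+\<omega>. ?h \<omega> + ?h (exchange_draws {e} \<omega>) \<partial>\<Omega>)"
  proof (rule nn_integral_mono)
    fix \<omega>
    assume "\<omega> \<in> space \<Omega>"
    then interpret distinct_draws B I E "sample_key \<omega>" "reward_key \<omega>"
      by (rule distinct)
    show "(if e \<in> lead \<omega> then gain \<omega> e else 0) \<le> ?h \<omega> + ?h (exchange_draws {e} \<omega>)"
      using draw_cases[OF e] lead_swap[OF e order_refl]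
      by (auto simp: requests_def gain_def)
  qed
  also have "\<dots> = (\<integral>\<^sup>+\<omega>. ?h \<omega> \<partial>\<Omega>) + (\<integral>\<^sup>+\<omega>. ?h (exchange_draws {e} \<omega>) \<partial>\<Omega>)"
    by (intro nn_integral_add h measurable_compose[OF exchange_draws_measurable h])
  also have "\<dots> = 2 * (\<integral>\<^sup>+\<omega>. ?h \<omega> \<partial>\<Omega>)"
    by (simp only: nn_integral_exchange[OF h] mult_2)
  finally show ?thesis .
qed

text \<open>A request that is not least has a next lead \<open>g\<close> showing heads. Exchanging
  the draws of \<open>g\<close> maps this event into the one with tails, where the request is least.
  Summed over \<open>g\<close>, the tails events contribute at most the least requests once
  more.\<close>

lemma request_le_least:
  assumes e: "e \<in> E"
  shows "(\<integral>\<^sup>+\<omega>. (if e \<in> request \<omega> then gain \<omega> e else 0) \<partial>\<Omega>)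
    \<le> 2 * (\<integral>\<^sup>+\<omega>. (if e \<in> least \<omega> then gain \<omega> e else 0) \<partial>\<Omega>)"
proof -
  note [measurable] = e
  let ?l = "\<lambda>\<omega>. if e \<in> least \<omega> then gain \<omega> e else 0"
  let ?H = "\<lambda>g \<omega>. if e \<in> request \<omega> \<and> g \<in> succ \<omega> e \<and> heads \<omega> g then gain \<omega> e else 0"
  let ?T = "\<lambda>g \<omega>. if e \<in> request \<omega> \<and> g \<in> succ \<omega> e \<and> \<not> heads \<omega> g then gain \<omega> e else 0"
  have l: "?l \<in> borel_measurable \<Omega>"
    by measurable
  have H: "?H g \<in> borel_measurable \<Omega>" and T: "?T g \<in> borel_measurable \<Omega>" if [measurable]: "g \<in> E" for g
    by measurable
  \<comment> \<open>The peak of \<open>g\<close> lies below that of \<open>e\<close>, so the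
    exchange of \<open>g\<close> keeps the request of \<open>e\<close>, its gain and the role of
    \<open>g\<close>.\<close>
  have HT: "(\<integral>\<^sup>+\<omega>. ?H g \<omega> \<partial>\<Omega>) \<le> (\<integral>\<^sup>+\<omega>. ?T g \<omega> \<partial>\<Omega>)" if g: "g \<in> E" for g
  proof -
    have "(\<integral>\<^sup>+\<omega>. ?H g \<omega> \<partial>\<Omega>) \<le> (\<integral>\<^sup>+\<omega>. ?T g (exchange_draws {g} \<omega>) \<partial>\<Omega>)"
    proof (rule nn_integral_mono)
      fix \<omega>
      assume "\<omega> \<in> space \<Omega>"
      then interpret distinct_draws B I E "sample_key \<omega>" "reward_key \<omega>"
        by (rule distinct)
      have "peak (sample_key \<omega>) (reward_key \<omega>) g < peak (sample_key \<omega>) (reward_key \<omega>) e"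
        if "g \<in> succ \<omega> e"
        using that unfolding next_leads_def by blast
      then show "?H g \<omega> \<le> ?T g (exchange_draws {g} \<omega>)"
        using next_swap[OF g, of e] requests_swap[OF g, of e] by (auto simp: gain_def)
    qed
    then show ?thesis
      by (simp only: nn_integral_exchange[OF T[OF g]])
  qed
  have "(\<integral>\<^sup>+\<omega>. (if e \<in> request \<omega> then gain \<omega> e else 0) \<partial>\<Omega>) \<le> (\<integral>\<^sup>+\<omega>. ?l \<omega> + (\<Sum>g\<in>E. ?H g \<omega>) \<partial>\<Omega>)"
  proof (rule nn_integral_mono)
    fix \<omega>
    assume "\<omega> \<in> space \<Omega>"
    then interpret distinct_draws B I E "sample_key \<omega>" "reward_key \<omega>"
      by (rule distinct)
    show "(if e \<in> request \<omega> then gain \<omega> e else 0) \<le> ?l \<omega> + (\<Sum>g\<in>E. ?H g \<omega>)"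
    proof (cases "e \<in> request \<omega> \<and> e \<notin> least \<omega>")
      case True
      then obtain g where g: "g \<in> succ \<omega> e" "heads \<omega> g"
        using least_request_or_next by blast
      then have "g \<in> E"
        using lead_sub open_sub unfolding next_leads_def by blast
      then have "?H g \<omega> \<le> (\<Sum>g\<in>E. ?H g \<omega>)"
        by (intro member_le_sum fin) auto
      then show ?thesis
        using True g by simp
    qed auto
  qed
  also have "\<dots> = (\<integral>\<^sup>+\<omega>. ?l \<omega> \<partial>\<Omega>) + (\<Sum>g\<in>E. \<integral>\<^sup>+\<omega>. ?H g \<omega> \<partial>\<Omega>)"
    using l H by (subst nn_integral_add) (auto simp: nn_integral_sum)
  also have "\<dots> \<le> (\<integral>\<^sup>+\<omega>. ?l \<omega> \<partial>\<Omega>) + (\<Sum>g\<in>E. \<integral>\<^sup>+\<omega>. ?T g \<omega> \<partial>\<Omega>)"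
    using HT by (intro add_left_mono sum_mono)
  also have "(\<Sum>g\<in>E. \<integral>\<^sup>+\<omega>. ?T g \<omega> \<partial>\<Omega>) = (\<integral>\<^sup>+\<omega>. (\<Sum>g\<in>E. ?T g \<omega>) \<partial>\<Omega>)"
    using T by (subst nn_integral_sum) auto
  also have "\<dots> \<le> (\<integral>\<^sup>+\<omega>. ?l \<omega> \<partial>\<Omega>)"
  proof (rule nn_integral_mono)
    fix \<omega>
    assume "\<omega> \<in> space \<Omega>"
    then interpret distinct_draws B I E "sample_key \<omega>" "reward_key \<omega>"
      by (rule distinct)
    show "(\<Sum>g\<in>E. ?T g \<omega>) \<le> ?l \<omega>"
    proof (cases "\<exists>g\<in>E. e \<in> request \<omega> \<and> g \<in> succ \<omega> e \<and> \<not> heads \<omega> g")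
      case True
      then obtain g where g: "g \<in> E" "e \<in> request \<omega>" "g \<in> succ \<omega> e" "\<not> heads \<omega> g"
        by blast
      then have "e \<in> least \<omega>"
        using next_tails_least_request draw_cases by blast
      \<comment> \<open>At most one lead is next after \<open>e\<close>, so the tails events are
        disjoint and a single summand survives.\<close>
      have "(\<Sum>g\<in>E. ?T g \<omega>) = (\<Sum>h\<in>{g}. ?T h \<omega>)"
        using g next_unique fin by (intro sum.mono_neutral_right) auto
      then show ?thesis
        using g \<open>e \<in> least \<omega>\<close> by simp
    next
      case False
      then have "(\<Sum>g\<in>E. ?T g \<omega>) = 0"
        by (intro sum.neutral) auto
      then show ?thesis
        by simp
    qed
  qed
  finally show ?thesis
    by (simp add: mult_2 add_left_mono)
qed

lemma AE_draws_nonneg: "AE \<omega> in \<Omega>. \<forall>x\<in>draws E. 0 \<le> fst \<omega> x"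
proof -
  interpret V: prob_space vals by (rule prob_values)
  interpret R: prob_space ranks by (rule prob_ranks)
  interpret pair_sigma_finite vals ranks ..
  have "AE v in vals. \<forall>x\<in>draws E. 0 \<le> v x"
    using fin(2) prob_D nonneg_D
    by (intro AE_finite_allI AE_PiM_component) (auto simp: draws_iff)
  then have "AE v in vals. AE \<tau> in ranks. \<forall>x\<in>draws E. 0 \<le> fst (v, \<tau>) x"
    by eventually_elim auto
  moreover have "{\<omega> \<in> space (vals \<Otimes>\<^sub>M ranks). \<forall>x\<in>draws E. 0 \<le> fst \<omega> x} \<in> sets (vals \<Otimes>\<^sub>M ranks)"
    using fin(2) value_measurable unfolding outcomes_def by measurable
  ultimately show ?thesis
    unfolding outcomes_def by (intro AE_pair_measure)
qed

lemma AE_outcome: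
  "AE \<omega> in \<Omega>. \<omega> \<in> space \<Omega> \<and> (\<forall>e\<in>E. 0 \<le> fst \<omega> (Reward e) \<and> 0 \<le> fst \<omega> (Sample e))"
  using AE_draws_nonneg AE_space by eventually_elim auto

lemma sum_if_ennreal:
  assumes "A \<subseteq> E" "\<And>e. e \<in> E \<Longrightarrow> 0 \<le> w e"
  shows "(\<Sum>e\<in>E. if e \<in> A then ennreal (w e) else 0) = ennreal (sum w A)"
proof -
  have "(\<Sum>e\<in>E. if e \<in> A then ennreal (w e) else 0) = (\<Sum>e\<in>A. ennreal (w e))"
    using assms(1) fin(1) by (simp add: sum.If_cases Int_absorb1)
  also have "\<dots> = ennreal (sum w A)"
    using assms by (intro sum_ennreal) auto
  finally show ?thesis .
qed

text \<open>Summing over the fixed set \<open>E\<close> with indicators, instead of over the random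
  matching, lets measurability be checked term by term.\<close>

definition greedy_gain :: "'v set outcome \<Rightarrow> ennreal" where
  "greedy_gain \<omega> = (\<Sum>e\<in>E. if e \<in> greedy \<omega> then ennreal (fst \<omega> (Sample e)) else 0)"

lemma greedy_gain_measurable [measurable]: "greedy_gain \<in> borel_measurable \<Omega>"
  unfolding greedy_gain_def by measurable

text \<open>Greedy on the rewards earns at least half the optimum in almost every outcome.
  Exchanging all samples with all rewards turns it into greedy on the samples without changing the
  expectation.\<close>

lemma OPT_le_greedy:
  "(\<integral>\<^sup>+\<omega>. ennreal (OPT E (reward \<omega>)) \<partial>\<Omega>) \<le> 2 * (\<integral>\<^sup>+\<omega>. greedy_gain \<omega> \<partial>\<Omega>)"
proof -
  have "(\<integral>\<^sup>+\<omega>. ennreal (OPT E (reward \<omega>)) \<partial>\<Omega>)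
      \<le> (\<integral>\<^sup>+\<omega>. 2 * greedy_gain (exchange_draws UNIV \<omega>) \<partial>\<Omega>)"
  proof (rule nn_integral_mono_AE)
    show "AE \<omega> in \<Omega>. ennreal (OPT E (reward \<omega>)) \<le> 2 * greedy_gain (exchange_draws UNIV \<omega>)"
      using AE_outcome
    proof eventually_elim
      fix \<omega>
      assume \<omega>: "\<omega> \<in> space \<Omega> \<and> (\<forall>e\<in>E. 0 \<le> fst \<omega> (Reward e) \<and> 0 \<le> fst \<omega> (Sample e))"
      then interpret distinct_draws B I E "sample_key \<omega>" "reward_key \<omega>"
        using distinct by blast
      let ?G = "greedy_matching E (reward_key \<omega>)"
      have G: "?G \<subseteq> E"
        using greedy_matching_greedy(2)[OF fin inj_r] unfolding is_greedy_def by blast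
      have nonneg: "0 \<le> reward \<omega> e" if "e \<in> E" for e
        using \<omega> that by (simp add: reward_def)
      have mono: "reward \<omega> e \<le> reward \<omega> f" if "reward_key \<omega> e \<le> reward_key \<omega> f" for e f
        using key_value_mono[OF that] by (simp add: reward_def reward_key_def)
      have "OPT E (reward \<omega>) \<le> 2 * weight (reward \<omega>) ?G"
        unfolding OPT_def
      proof (rule Max.boundedI)
        show "finite (weight (reward \<omega>) ` {M. M \<subseteq> E \<and> matching M})"
          using fin by simp
        show "weight (reward \<omega>) ` {M. M \<subseteq> E \<and> matching M} \<noteq> {}"
          by (auto simp: matching_def intro: exI[of _ "{}"])
      qed (auto intro!: weight_matching_le_twice_greedy[OF bip inj_r] mono nonneg)
      then have "ennreal (OPT E (reward \<omega>)) \<le> ennreal (2 * weight (reward \<omega>) ?G)"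
        by (rule ennreal_leI)
      also have "\<dots> = 2 * ennreal (weight (reward \<omega>) ?G)"
        using G nonneg by (subst ennreal_mult) (auto simp: weight_def intro!: sum_nonneg)
      also have "ennreal (weight (reward \<omega>) ?G) = greedy_gain (exchange_draws UNIV \<omega>)"
      proof -
        have "fst (exchange_draws UNIV \<omega>) (Sample e) = reward \<omega> e" for e
          by (simp add: exchange_draws_def exchange_def reward_def)
        then show ?thesis
          using sum_if_ennreal[OF G, of "reward \<omega>"] nonneg
          by (simp add: greedy_gain_def weight_def cong: if_cong)
      qed
      finally show "ennreal (OPT E (reward \<omega>)) \<le> 2 * greedy_gain (exchange_draws UNIV \<omega>)" .
    qed
  qed
  also have "\<dots> = 2 * (\<integral>\<^sup>+\<omega>. greedy_gain (exchange_draws UNIV \<omega>) \<partial>\<Omega>)"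
    by (intro nn_integral_cmult measurable_compose[OF exchange_draws_measurable]) measurable
  also have "\<dots> = 2 * (\<integral>\<^sup>+\<omega>. greedy_gain \<omega> \<partial>\<Omega>)"
    by (simp add: nn_integral_exchange)
  finally show ?thesis .
qed

lemma greedy_le_lead:
  "(\<integral>\<^sup>+\<omega>. greedy_gain \<omega> \<partial>\<Omega>) \<le> (\<Sum>e\<in>E. \<integral>\<^sup>+\<omega>. (if e \<in> lead \<omega> then gain \<omega> e else 0) \<partial>\<Omega>)"
proof -
  have "(\<integral>\<^sup>+\<omega>. greedy_gain \<omega> \<partial>\<Omega>) \<le> (\<integral>\<^sup>+\<omega>. (\<Sum>e\<in>E. if e \<in> lead \<omega> then gain \<omega> e else 0) \<partial>\<Omega>)"
  proof (rule nn_integral_mono_AE)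
    show "AE \<omega> in \<Omega>. greedy_gain \<omega> \<le> (\<Sum>e\<in>E. if e \<in> lead \<omega> then gain \<omega> e else 0)"
      using AE_outcome
    proof eventually_elim
      fix \<omega>
      assume \<omega>: "\<omega> \<in> space \<Omega> \<and> (\<forall>e\<in>E. 0 \<le> fst \<omega> (Reward e) \<and> 0 \<le> fst \<omega> (Sample e))"
      then interpret distinct_draws B I E "sample_key \<omega>" "reward_key \<omega>"
        using distinct by blast
      let ?p = "peak (sample_key \<omega>) (reward_key \<omega>)"
      have s: "key_value (sample_key \<omega> e) = fst \<omega> (Sample e)" for e
        by (simp add: sample_key_def)
      have le: "key_value (sample_key \<omega> e) \<le> key_value (?p e)" for e
        by (intro key_value_mono) (simp add: peak_def)
      have "sum (\<lambda>e. fst \<omega> (Sample e)) SM \<le> sum (\<lambda>e. key_value (?p e)) (lead \<omega>)"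
      proof (rule sum_SM_le_sum_lead)
        fix e f
        assume "?p e \<le> ?p f"
        then show "fst \<omega> (Sample e) \<le> key_value (?p f)"
          using key_value_mono le[of e] s by fastforce
      next
        fix e
        assume "e \<in> E"
        then show "0 \<le> key_value (?p e)"
          using le[of e] s[of e] \<omega> by force
      qed
      moreover have "0 \<le> key_value (?p e)" if "e \<in> E" for e
        using le[of e] s[of e] \<omega> that by force
      moreover have "lead \<omega> \<subseteq> E"
        using lead_sub open_sub by blast
      ultimately show "greedy_gain \<omega> \<le> (\<Sum>e\<in>E. if e \<in> lead \<omega> then gain \<omega> e else 0)"
        using SM_sub \<omega> unfolding greedy_gain_def gain_def
        by (simp add: sum_if_ennreal ennreal_leI)
    qed
  qed
  also have "\<dots> = (\<Sum>e\<in>E. \<integral>\<^sup>+\<omega>. (if e \<in> lead \<omega> then gain \<omega> e else 0) \<partial>\<Omega>)"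
    by (intro nn_integral_sum) measurable
  finally show ?thesis .
qed

text \<open>The comparison is made outcome by outcome, so the arrival order may depend on all
  draws.\<close>

lemma least_le_online:
  assumes "\<And>\<omega>. \<omega> \<in> space \<Omega> \<Longrightarrow> set (arrival \<omega>) = B"
  shows "(\<Sum>e\<in>E. \<integral>\<^sup>+\<omega>. (if e \<in> least \<omega> then gain \<omega> e else 0) \<partial>\<Omega>)
    \<le> (\<integral>\<^sup>+\<omega>. ennreal (weight (reward \<omega>) (alg_matching E \<omega> (arrival \<omega>))) \<partial>\<Omega>)"
proof -
  have "(\<Sum>e\<in>E. \<integral>\<^sup>+\<omega>. (if e \<in> least \<omega> then gain \<omega> e else 0) \<partial>\<Omega>)
      = (\<integral>\<^sup>+\<omega>. (\<Sum>e\<in>E. if e \<in> least \<omega> then gain \<omega> e else 0) \<partial>\<Omega>)"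
    by (intro nn_integral_sum[symmetric]) measurable
  also have "\<dots> \<le> (\<integral>\<^sup>+\<omega>. ennreal (weight (reward \<omega>) (alg_matching E \<omega> (arrival \<omega>))) \<partial>\<Omega>)"
  proof (rule nn_integral_mono_AE)
    show "AE \<omega> in \<Omega>. (\<Sum>e\<in>E. if e \<in> least \<omega> then gain \<omega> e else 0)
        \<le> ennreal (weight (reward \<omega>) (alg_matching E \<omega> (arrival \<omega>)))"
      using AE_outcome
    proof eventually_elim
      fix \<omega>
      assume \<omega>: "\<omega> \<in> space \<Omega> \<and> (\<forall>e\<in>E. 0 \<le> fst \<omega> (Reward e) \<and> 0 \<le> fst \<omega> (Sample e))"
      then interpret distinct_draws B I E "sample_key \<omega>" "reward_key \<omega>"
        using distinct by blast
      have nonneg: "0 \<le> reward \<omega> e" "0 \<le> reward_key \<omega> e" if "e \<in> E" for e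
        using \<omega> that by (auto simp: reward_def reward_key_def zero_key_def less_eq_key_def)
      have least: "least \<omega> \<subseteq> request \<omega>"
        unfolding least_requests_def by blast
      have "sum (reward \<omega>) (least \<omega>) \<le> weight (reward \<omega>) (alg_matching E \<omega> (arrival \<omega>))"
        unfolding alg_matching_def
      proof (rule sum_least_requests_le_online)
        fix e f
        assume "reward_key \<omega> e \<le> reward_key \<omega> f"
        then show "reward \<omega> e \<le> reward \<omega> f"
          using key_value_mono by (fastforce simp: reward_def reward_key_def)
      qed (use nonneg assms \<omega> in auto)
      \<comment> \<open>A least request shows heads, so its peak is its reward and its gain is a
        weight that can actually be earned.\<close>
      moreover have "gain \<omega> e = ennreal (reward \<omega> e)" if "e \<in> least \<omega>" for e
        using that least unfolding requests_def gain_def peak_def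
        by (auto simp: reward_def reward_key_def max_def)
      then have "(\<Sum>e\<in>E. if e \<in> least \<omega> then gain \<omega> e else 0) = ennreal (sum (reward \<omega>) (least \<omega>))"
        using least requests_sub lead_sub open_sub nonneg
        by (subst sum_if_ennreal[symmetric]) (auto intro!: sum.cong)
      ultimately show "(\<Sum>e\<in>E. if e \<in> least \<omega> then gain \<omega> e else 0)
          \<le> ennreal (weight (reward \<omega>) (alg_matching E \<omega> (arrival \<omega>)))"
        by (simp add: ennreal_leI)
    qed
  qed
  finally show ?thesis .
qed

end

theorem theorem2:
  fixes B I :: "'v set" and E :: "'v set set"
    and D :: "'v set \<Rightarrow> real measure"
    and arrival :: "'v set outcome \<Rightarrow> 'v list"
  assumes "bipartite_graph B I E"
    and "\<And>e. e \<in> E \<Longrightarrow> prob_space (D e)"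
    and "\<And>e. e \<in> E \<Longrightarrow> sets (D e) = sets borel"
    and "\<And>e. e \<in> E \<Longrightarrow> AE x in D e. 0 \<le> x"
    and "arrival \<in> outcomes E D \<rightarrow>\<^sub>M count_space (permutations_of_set B)"
  shows "8 * (\<integral>\<^sup>+ \<omega>. ennreal (weight (reward \<omega>) (alg_matching E \<omega> (arrival \<omega>))) \<partial>outcomes E D)
           \<ge> (\<integral>\<^sup>+ \<omega>. ennreal (OPT E (reward \<omega>)) \<partial>outcomes E D)"
proof -
  interpret random_draws B I E D
    using assms(1-4) by (rule random_draws.intro)
  have arrival: "set (arrival \<omega>) = B" if "\<omega> \<in> space \<Omega>" for \<omega>
    using measurable_space[OF assms(5) that] by (auto simp: permutations_of_set_def)
  let ?L = "\<lambda>e. \<integral>\<^sup>+\<omega>. (if e \<in> lead \<omega> then gain \<omega> e else 0) \<partial>\<Omega>"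
  let ?F = "\<lambda>e. \<integral>\<^sup>+\<omega>. (if e \<in> least \<omega> then gain \<omega> e else 0) \<partial>\<Omega>"
  \<comment> \<open>One factor 2 passes from leads to requests, the other from requests to least
    requests.\<close>
  have "?L e \<le> 4 * ?F e" if "e \<in> E" for e
  proof -
    have "?L e \<le> 2 * (2 * ?F e)"
      using lead_le_request[OF that] mult_left_mono[OF request_le_least[OF that], of 2]
      by (meson order_trans zero_le)
    then show ?thesis
      by (simp add: mult.assoc[symmetric])
  qed
  then have "(\<Sum>e\<in>E. ?L e) \<le> 4 * (\<Sum>e\<in>E. ?F e)"
    by (simp add: sum_distrib_left sum_mono)
  also have "\<dots> \<le> 4 * (\<integral>\<^sup>+\<omega>. ennreal (weight (reward \<omega>) (alg_matching E \<omega> (arrival \<omega>))) \<partial>\<Omega>)"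
    using least_le_online[OF arrival] by (intro mult_left_mono) auto
  finally have "2 * (\<Sum>e\<in>E. ?L e)
      \<le> 2 * (4 * (\<integral>\<^sup>+\<omega>. ennreal (weight (reward \<omega>) (alg_matching E \<omega> (arrival \<omega>))) \<partial>\<Omega>))"
    by (intro mult_left_mono) auto
  \<comment> \<open>The last factor 2 is the loss of the greedy matching against the
    optimum.\<close>
  moreover have "(\<integral>\<^sup>+\<omega>. ennreal (OPT E (reward \<omega>)) \<partial>\<Omega>) \<le> 2 * (\<Sum>e\<in>E. ?L e)"
    using OPT_le_greedy mult_left_mono[OF greedy_le_lead, of 2] by (meson order_trans zero_le)
  ultimately show ?thesis
    by (simp add: mult.assoc[symmetric])
qed

end
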